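(* Let $(M,\lambda_{(i)}(x,y))$ be a GAP-space equipped with a non-linear connection $N^\alpha_\mu$, and let $|$, $||$ be the $h$- and $v$-covariant derivatives of its canonical $d$-connection. The $hW$-tensor $\widetilde H^\alpha_{\mu\nu\sigma}$ and the $vW$-tensor $\widetilde V^\alpha_{\mu\nu\sigma}$ of the dual $d$-connection, the $hW$-tensor $\widehat H^\alpha_{\mu\nu\sigma}$ of the symmetric $d$-connection and the $hW$-tensor $\mathring H^\alpha_{\mu\nu\sigma}$ of the Riemannian $d$-connection can be expressed in the form: (a) $\widetilde H^\alpha_{\mu\nu\sigma}=\Lambda^\alpha_{\sigma\nu|\mu}+\Lambda^\epsilon_{\nu\sigma}\Lambda^\alpha_{\mu\epsilon}+\mathfrak S_{\mu,\nu,\sigma}L^\alpha_{\mu\sigma\nu}$; (b) $\widetilde V^\alpha_{\mu\nu\sigma}=T^\alpha_{\sigma\nu||\mu}+T^\epsilon_{\nu\sigma}T^\alpha_{\mu\epsilon}$; (c) $\widehat H^\alpha_{\mu\nu\sigma}=\tfrac12(\Lambda^\alpha_{\mu\nu|\sigma}-\Lambda^\alpha_{\mu\sigma|\nu})+\tfrac14(\Lambda^\epsilon_{\mu\nu}\Lambda^\alpha_{\sigma\epsilon}-\Lambda^\epsilon_{\mu\sigma}\Lambda^\alpha_{\nu\epsilon})+\tfrac12\Lambda^\epsilon_{\sigma\nu}\Lambda^\alpha_{\epsilon\mu}$; (d) $\mathring H^\alpha_{\mu\nu\sigma}=\gamma^\alpha_{\mu\nu|\sigma}-\gamma^\alpha_{\mu\sigma|\nu}+\gamma^\epsilon_{\mu\sigma}\gamma^\alpha_{\epsilon\nu}-\gamma^\epsilon_{\mu\nu}\gamma^\alpha_{\epsilon\sigma}+\Lambda^\epsilon_{\nu\sigma}\gamma^\alpha_{\mu\epsilon}$,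 where $\mathfrak S_{\mu,\nu,\sigma}$ denotes the sum over cyclic permutations of $\mu,\nu,\sigma$.
   Context: $M$ is a $C^\infty$ manifold of dimension $n$, $\pi:TM\to M$ its tangent bundle with induced local coordinates $(x^\mu,y^\mu)$; $\partial_\mu=\partial/\partial x^\mu$, $\dot\partial_\mu=\partial/\partial y^\mu$. All objects are smooth in $(x,y)$. Summation convention on repeated Greek and repeated Latin indices. A non-linear connection is a system of functions $N^\alpha_\beta(x,y)$ on induced charts of $TM$ transforming by $N^{\alpha'}_{\beta'}=p^{\alpha'}_{\alpha}p^{\beta}_{\beta'}N^\alpha_\beta+p^{\alpha'}_{\epsilon}p^{\epsilon}_{\beta'\sigma'}y^{\sigma'}$, where $p^{\alpha'}_{\alpha}=\partial x^{\alpha'}/\partial x^{\alpha}$, $p^{\epsilon}_{\beta'\sigma'}=\partial^2x^\epsilon/\partial x^{\beta'}\partial x^{\sigma'}$; set $\delta_\mu=\partial_\mu-N^\alpha_\mu\dot\partial_\alpha$ and $R^\alpha_{\sigma\mu}:=\delta_\mu N^\alpha_\sigma-\delta_\sigma N^\alpha_\mu$ (curvature of $N$). A GAP-space is a manifold $M$ together with $n$ global linearly independent sections $\lambda_{(i)}=(\lambda_{(i)}^\alpha(x,y))$ of the pullback bundle $\pi^{-1}(TM)$; $(\lambda_{(i)\alpha})$ is the inverse matrix ($\lambda_{(i)}^\alpha\lambda_{(i)\beta}=\delta^\alpha_\beta$, $\lambda_{(i)}^\alpha\lambda_{(j)\alpha}=\delta_{ij}$), and $g_{\mu\nu}=\lambda_{(i)\mu}\lambda_{(i)\nu}$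 its metric, with inverse $g^{\mu\nu}$. $d$-connections (all with the same $N$): - canonical $D=(N,\Gamma,C)$: $\Gamma^\alpha_{\mu\nu}=\lambda_{(i)}^\alpha\delta_\nu\lambda_{(i)\mu}$, $C^\alpha_{\mu\nu}=\lambda_{(i)}^\alpha\dot\partial_\nu\lambda_{(i)\mu}$; - Riemannian $\mathring D=(N,\mathring\Gamma,\mathring C)$: $\mathring\Gamma^\alpha_{\mu\nu}=\tfrac12g^{\alpha\epsilon}(\delta_\mu g_{\nu\epsilon}+\delta_\nu g_{\mu\epsilon}-\delta_\epsilon g_{\mu\nu})$, $\mathring C^\alpha_{\mu\nu}=\tfrac12g^{\alpha\epsilon}(\dot\partial_\mu g_{\nu\epsilon}+\dot\partial_\nu g_{\mu\epsilon}-\dot\partial_\epsilon g_{\mu\nu})$; - dual $\widetilde D=(N,\widetilde\Gamma,\widetilde C)$: $\widetilde\Gamma^\alpha_{\mu\nu}=\Gamma^\alpha_{\nu\mu}$, $\widetilde C^\alpha_{\mu\nu}=C^\alpha_{\nu\mu}$; - symmetric $\widehat D=(N,\widehat\Gamma,\widehat C)$: $\widehat\Gamma^\alpha_{\mu\nu}=\tfrac12(\Gamma^\alpha_{\mu\nu}+\Gamma^\alpha_{\nu\mu})$, $\widehat C^\alpha_{\mu\nu}=\tfrac12(C^\alpha_{\mu\nu}+C^\alpha_{\nu\mu})$. For a $d$-connection $(N,\Gamma,C)$ the $h$- and $v$-covariant derivatives are $A^\alpha_{\mu|\nu}=\delta_\nu A^\alpha_\mu+A^\epsilon_\mu\Gamma^\alpha_{\epsilon\nu}-A^\alpha_\epsilon\Gamma^\epsilon_{\mu\nu}$,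 $A^\alpha_{\mu||\nu}=\dot\partial_\nu A^\alpha_\mu+A^\epsilon_\mu C^\alpha_{\epsilon\nu}-A^\alpha_\epsilon C^\epsilon_{\mu\nu}$ (similarly for other tensor types); $X_{\mu|\nu\sigma}:=(X_{\mu|\nu})_{|\sigma}$, $X_{\mu||\nu\sigma}:=(X_{\mu||\nu})_{||\sigma}$. Its $hW$-tensor $H^\alpha_{\mu\nu\sigma}$ and $vW$-tensor $V^\alpha_{\mu\nu\sigma}$ are defined by requiring, for every $i$, $$\lambda_{(i)\mu|\nu\sigma}-\lambda_{(i)\mu|\sigma\nu}=\lambda_{(i)\epsilon}H^\epsilon_{\mu\nu\sigma},\qquad \lambda_{(i)\mu||\nu\sigma}-\lambda_{(i)\mu||\sigma\nu}=\lambda_{(i)\epsilon}V^\epsilon_{\mu\nu\sigma},$$ with covariant derivatives taken with respect to that $d$-connection. The $W$-tensors of $\widetilde D,\widehat D,\mathring D$ carry the corresponding decoration. Tensors of the canonical $d$-connection: $\Lambda^\alpha_{\mu\nu}=\Gamma^\alpha_{\mu\nu}-\Gamma^\alpha_{\nu\mu}$, $T^\alpha_{\mu\nu}=C^\alpha_{\mu\nu}-C^\alpha_{\nu\mu}$, $\gamma^\alpha_{\mu\nu}=\Gamma^\alpha_{\mu\nu}-\mathring\Gamma^\alpha_{\mu\nu}$, $L^\alpha_{\nu\mu\sigma}=C^\alpha_{\nu\epsilon}R^\epsilon_{\mu\sigma}$. *)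

theory Defs
  imports "HOL-Analysis.Analysis"
begin

section \<open>Smooth functions and smooth manifolds\<close>

text \<open>Only meaningful for open \<open>S\<close>: derivatives are taken in the ambient space.\<close>

primrec Ck_on :: "nat \<Rightarrow> ('a::real_normed_vector \<Rightarrow> 'b::real_normed_vector) \<Rightarrow> 'a set \<Rightarrow> bool" where
  "Ck_on 0 f S \<longleftrightarrow> continuous_on S f"
| "Ck_on (Suc k) f S \<longleftrightarrow>
     (\<forall>x\<in>S. f differentiable (at x)) \<and> (\<forall>v. Ck_on k (\<lambda>x. frechet_derivative f (at x) v) S)"

definition smooth_on :: "('a::real_normed_vector \<Rightarrow> 'b::real_normed_vector) \<Rightarrow> 'a set \<Rightarrow> bool" where
  "smooth_on f S \<longleftrightarrow> (\<forall>k. Ck_on k f S)"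

text \<open>A chart is a pair of its domain and its coordinate map; the values of the coordinate map
  outside the domain play no role.\<close>

type_synonym ('m, 'n) chart = "'m set \<times> ('m \<Rightarrow> real^'n)"

definition transition :: "('m, 'n::finite) chart \<Rightarrow> ('m, 'n) chart \<Rightarrow> real^'n \<Rightarrow> real^'n" where
  "transition c d = snd d \<circ> inv_into (fst c) (snd c)"

definition smooth_manifold :: "'m topology \<Rightarrow> ('m, 'n::finite) chart set \<Rightarrow> bool" where
  "smooth_manifold M A \<longleftrightarrow>
     Hausdorff_space M \<and> second_countable M \<and>
     (\<forall>(U, \<phi>)\<in>A. openin M U \<and> open (\<phi> ` U) \<and>
        homeomorphic_map (subtopology M U) (top_of_set (\<phi> ` U)) \<phi>) \<and>
     (\<Union>(U, \<phi>)\<in>A. U) = topspace M \<and>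
     (\<forall>c\<in>A. \<forall>d\<in>A. smooth_on (transition c d) (snd c ` (fst c \<inter> fst d)))"

definition pd :: "'n::finite \<Rightarrow> (real^'n \<Rightarrow> real) \<Rightarrow> real^'n \<Rightarrow> real" where
  "pd \<mu> f x = frechet_derivative f (at x) (axis \<mu> 1)"

text \<open>With \<open>c\<close>, \<open>d\<close> having coordinates \<open>x\<close> and \<open>x'\<close>: \<open>jac c d x \<alpha>' \<alpha>\<close> is
  \<open>\<partial>x'\<^sup>\<alpha>\<^sup>' / \<partial>x\<^sup>\<alpha>\<close>, and \<open>hess c d x \<alpha>' \<beta> \<sigma>\<close> is
  \<open>\<partial>\<^sup>2x'\<^sup>\<alpha>\<^sup>' / \<partial>x\<^sup>\<beta>\<partial>x\<^sup>\<sigma>\<close>.\<close>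

definition jac :: "('m, 'n::finite) chart \<Rightarrow> ('m, 'n) chart \<Rightarrow> real^'n \<Rightarrow> 'n \<Rightarrow> 'n \<Rightarrow> real" where
  "jac c d x \<alpha> \<beta> = pd \<beta> (\<lambda>x. transition c d x $ \<alpha>) x"

definition hess :: "('m, 'n::finite) chart \<Rightarrow> ('m, 'n) chart \<Rightarrow> real^'n \<Rightarrow> 'n \<Rightarrow> 'n \<Rightarrow> 'n \<Rightarrow> real" where
  "hess c d x \<alpha> \<beta> \<sigma> = pd \<beta> (pd \<sigma> (\<lambda>x. transition c d x $ \<alpha>)) x"


section \<open>The tangent bundle and its pullback\<close>

text \<open>A tangent vector at \<open>p\<close> is the family of its component vectors in the charts around \<open>p\<close>,
  related by the Jacobians of the transition maps (and set to \<open>0\<close> for all other charts, so that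
  equal tangent vectors are equal as functions).\<close>

type_synonym ('m, 'n) tvec = "('m, 'n) chart \<Rightarrow> real^'n"

definition tangent_space :: "('m, 'n::finite) chart set \<Rightarrow> 'm \<Rightarrow> ('m, 'n) tvec set" where
  "tangent_space A p =
     {v. (\<forall>c\<in>A. \<forall>d\<in>A. p \<in> fst c \<inter> fst d \<longrightarrow>
            (\<forall>\<alpha>. v d $ \<alpha> = (\<Sum>\<beta>\<in>UNIV. jac c d (snd c p) \<alpha> \<beta> * v c $ \<beta>))) \<and>
         (\<forall>c. \<not> (c \<in> A \<and> p \<in> fst c) \<longrightarrow> v c = 0)}"

definition tangent_bundle :: "'m topology \<Rightarrow> ('m, 'n::finite) chart set \<Rightarrow> ('m \<times> ('m, 'n) tvec) set" where
  "tangent_bundle M A = (SIGMA p : topspace M. tangent_space A p)"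

text \<open>Points \<open>(x, y)\<close> of an induced chart of the tangent bundle.\<close>

type_synonym 'n pt = "(real^'n) \<times> (real^'n)"

definition induced_chart :: "('m, 'n::finite) chart \<Rightarrow> 'm \<times> ('m, 'n) tvec \<Rightarrow> 'n pt" where
  "induced_chart c u = (snd c (fst u), snd u c)"

definition induced_dom :: "'m topology \<Rightarrow> ('m, 'n::finite) chart set \<Rightarrow> ('m, 'n) chart \<Rightarrow>
    ('m \<times> ('m, 'n) tvec) set" where
  "induced_dom M A c = {u \<in> tangent_bundle M A. fst u \<in> fst c}"

definition coord_dom :: "('m, 'n::finite) chart \<Rightarrow> 'n pt set" where
  "coord_dom c = snd c ` fst c \<times> UNIV"

text \<open>Components \<open>s\<^sup>\<alpha>(x,y)\<close>, in the chart \<open>c\<close>, of a section \<open>s\<close> of the pullback of the tangent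
  bundle along its own projection: \<open>s\<close> assigns to \<open>u\<close> in the tangent bundle a tangent vector at
  the base point of \<open>u\<close>.\<close>

definition section_comp :: "'m topology \<Rightarrow> ('m, 'n::finite) chart set \<Rightarrow> ('m, 'n) chart \<Rightarrow>
    ('m \<times> ('m, 'n) tvec \<Rightarrow> ('m, 'n) tvec) \<Rightarrow> 'n \<Rightarrow> 'n pt \<Rightarrow> real" where
  "section_comp M A c s \<alpha> z = s (inv_into (induced_dom M A c) (induced_chart c) z) c $ \<alpha>"

definition pullback_section :: "'m topology \<Rightarrow> ('m, 'n::finite) chart set \<Rightarrow>
    ('m \<times> ('m, 'n) tvec \<Rightarrow> ('m, 'n) tvec) \<Rightarrow> bool" where
  "pullback_section M A s \<longleftrightarrow>
     (\<forall>u\<in>tangent_bundle M A. s u \<in> tangent_space A (fst u)) \<and>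
     (\<forall>c\<in>A. \<forall>\<alpha>. smooth_on (section_comp M A c s \<alpha>) (coord_dom c))"

text \<open>The \<open>n\<close> sections are labelled by the type \<open>'n\<close> that also indexes the coordinates.\<close>

definition gap_space :: "'m topology \<Rightarrow> ('m, 'n::finite) chart set \<Rightarrow>
    ('n \<Rightarrow> 'm \<times> ('m, 'n) tvec \<Rightarrow> ('m, 'n) tvec) \<Rightarrow> bool" where
  "gap_space M A lam \<longleftrightarrow>
     smooth_manifold M A \<and> (\<forall>i. pullback_section M A (lam i)) \<and>
     (\<forall>u\<in>tangent_bundle M A. \<forall>a :: 'n \<Rightarrow> real.
        (\<forall>c. (\<Sum>i\<in>UNIV. a i *\<^sub>R lam i u c) = 0) \<longrightarrow> (\<forall>i. a i = 0))"

text \<open>\<open>N c \<alpha> \<beta>\<close> is \<open>N\<^sup>\<alpha>\<^sub>\<beta>\<close> in the induced chart of \<open>c\<close>.  In the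
  transformation law \<open>c\<close> is the unprimed and \<open>d\<close> the primed chart.\<close>

definition nonlinear_connection :: "'m topology \<Rightarrow> ('m, 'n::finite) chart set \<Rightarrow>
    (('m, 'n) chart \<Rightarrow> 'n \<Rightarrow> 'n \<Rightarrow> 'n pt \<Rightarrow> real) \<Rightarrow> bool" where
  "nonlinear_connection M A N \<longleftrightarrow>
     (\<forall>c\<in>A. \<forall>\<alpha> \<beta>. smooth_on (N c \<alpha> \<beta>) (coord_dom c)) \<and>
     (\<forall>c\<in>A. \<forall>d\<in>A. \<forall>u \<in> induced_dom M A c \<inter> induced_dom M A d.
        \<forall>\<alpha>' \<beta>'. let (x, y) = induced_chart c u; (x', y') = induced_chart d u in
          N d \<alpha>' \<beta>' (x', y') =
            (\<Sum>\<alpha>\<in>UNIV. \<Sum>\<beta>\<in>UNIV. jac c d x \<alpha>' \<alpha> * jac d c x' \<beta> \<beta>' * N c \<alpha> \<beta> (x, y)) +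
            (\<Sum>\<epsilon>\<in>UNIV. \<Sum>\<sigma>'\<in>UNIV. jac c d x \<alpha>' \<epsilon> * hess d c x' \<epsilon> \<beta>' \<sigma>' * y' $ \<sigma>'))"


section \<open>Local differential geometry in an induced chart\<close>

type_synonym 'n fld1 = "'n \<Rightarrow> 'n pt \<Rightarrow> real"
type_synonym 'n fld2 = "'n \<Rightarrow> 'n \<Rightarrow> 'n pt \<Rightarrow> real"
type_synonym 'n fld3 = "'n \<Rightarrow> 'n \<Rightarrow> 'n \<Rightarrow> 'n pt \<Rightarrow> real"
type_synonym 'n fld4 = "'n \<Rightarrow> 'n \<Rightarrow> 'n \<Rightarrow> 'n \<Rightarrow> 'n pt \<Rightarrow> real"

definition px :: "'n::finite \<Rightarrow> ('n pt \<Rightarrow> real) \<Rightarrow> 'n pt \<Rightarrow> real" where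
  "px \<mu> f z = frechet_derivative f (at z) (axis \<mu> 1, 0)"

definition py :: "'n::finite \<Rightarrow> ('n pt \<Rightarrow> real) \<Rightarrow> 'n pt \<Rightarrow> real" where
  "py \<mu> f z = frechet_derivative f (at z) (0, axis \<mu> 1)"

definition delta :: "'n::finite fld2 \<Rightarrow> 'n \<Rightarrow> ('n pt \<Rightarrow> real) \<Rightarrow> 'n pt \<Rightarrow> real" where
  "delta N \<mu> f z = px \<mu> f z - (\<Sum>\<alpha>\<in>UNIV. N \<alpha> \<mu> z * py \<alpha> f z)"

definition nl_curvature :: "'n::finite fld2 \<Rightarrow> 'n fld3" where
  "nl_curvature N \<alpha> \<sigma> \<mu> z = delta N \<mu> (N \<alpha> \<sigma>) z - delta N \<sigma> (N \<alpha> \<mu>) z"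

text \<open>Below, \<open>L i \<alpha>\<close> are the components \<open>\<lambda>\<^sub>(\<^sub>i\<^sub>)\<^sup>\<alpha>\<close> of the frame and
  \<open>low L i \<alpha>\<close> those of the inverse matrix \<open>\<lambda>\<^sub>(\<^sub>i\<^sub>)\<^sub>\<alpha>\<close>.  The latter is the inverse
  transpose, hence the exchanged indices.\<close>

definition low :: "'n::finite fld2 \<Rightarrow> 'n fld2" where
  "low L i \<alpha> z = matrix_inv (\<chi> j \<beta>. L j \<beta> z) $ \<alpha> $ i"

definition metric :: "'n::finite fld2 \<Rightarrow> 'n fld2" where
  "metric L \<mu> \<nu> z = (\<Sum>i\<in>UNIV. low L i \<mu> z * low L i \<nu> z)"

definition metric_inv :: "'n::finite fld2 \<Rightarrow> 'n fld2" where
  "metric_inv L \<mu> \<nu> z = matrix_inv (\<chi> \<alpha> \<beta>. metric L \<alpha> \<beta> z) $ \<mu> $ \<nu>"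

record ('n::finite) d_connection =
  nlc :: "'n fld2"
  hcoef :: "'n fld3"
  vcoef :: "'n fld3"

definition canonical :: "'n::finite fld2 \<Rightarrow> 'n fld2 \<Rightarrow> 'n d_connection" where
  "canonical N L =
     \<lparr> nlc = N,
       hcoef = (\<lambda>\<alpha> \<mu> \<nu> z. \<Sum>i\<in>UNIV. L i \<alpha> z * delta N \<nu> (low L i \<mu>) z),
       vcoef = (\<lambda>\<alpha> \<mu> \<nu> z. \<Sum>i\<in>UNIV. L i \<alpha> z * py \<nu> (low L i \<mu>) z) \<rparr>"

definition riemannian :: "'n::finite fld2 \<Rightarrow> 'n fld2 \<Rightarrow> 'n d_connection" where
  "riemannian N L =
     \<lparr> nlc = N,
       hcoef = (\<lambda>\<alpha> \<mu> \<nu> z. 1/2 * (\<Sum>\<epsilon>\<in>UNIV. metric_inv L \<alpha> \<epsilon> z *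
          (delta N \<mu> (metric L \<nu> \<epsilon>) z + delta N \<nu> (metric L \<mu> \<epsilon>) z - delta N \<epsilon> (metric L \<mu> \<nu>) z))),
       vcoef = (\<lambda>\<alpha> \<mu> \<nu> z. 1/2 * (\<Sum>\<epsilon>\<in>UNIV. metric_inv L \<alpha> \<epsilon> z *
          (py \<mu> (metric L \<nu> \<epsilon>) z + py \<nu> (metric L \<mu> \<epsilon>) z - py \<epsilon> (metric L \<mu> \<nu>) z))) \<rparr>"

definition dual :: "'n::finite fld2 \<Rightarrow> 'n fld2 \<Rightarrow> 'n d_connection" where
  "dual N L =
     \<lparr> nlc = N,
       hcoef = (\<lambda>\<alpha> \<mu> \<nu>. hcoef (canonical N L) \<alpha> \<nu> \<mu>),
       vcoef = (\<lambda>\<alpha> \<mu> \<nu>. vcoef (canonical N L) \<alpha> \<nu> \<mu>) \<rparr>"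

definition symmetric :: "'n::finite fld2 \<Rightarrow> 'n fld2 \<Rightarrow> 'n d_connection" where
  "symmetric N L =
     \<lparr> nlc = N,
       hcoef = (\<lambda>\<alpha> \<mu> \<nu> z. 1/2 * (hcoef (canonical N L) \<alpha> \<mu> \<nu> z + hcoef (canonical N L) \<alpha> \<nu> \<mu> z)),
       vcoef = (\<lambda>\<alpha> \<mu> \<nu> z. 1/2 * (vcoef (canonical N L) \<alpha> \<mu> \<nu> z + vcoef (canonical N L) \<alpha> \<nu> \<mu> z)) \<rparr>"

text \<open>The \<open>h\<close>- and \<open>v\<close>-covariant derivatives have the same shape, with derivations
  \<open>d \<nu> = \<delta>\<^sub>\<nu>\<close> and coefficients \<open>G = \<Gamma>\<close> in the first case, and
  \<open>\<partial>/\<partial>y\<^sup>\<nu>\<close> and \<open>C\<close> in the second.  The last index is the one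
  of differentiation; the names record the tensor type.\<close>

definition cov01 :: "('n::finite \<Rightarrow> ('n pt \<Rightarrow> real) \<Rightarrow> 'n pt \<Rightarrow> real) \<Rightarrow> 'n fld3 \<Rightarrow> 'n fld1 \<Rightarrow> 'n fld2" where
  "cov01 d G X \<mu> \<nu> z = d \<nu> (X \<mu>) z - (\<Sum>\<epsilon>\<in>UNIV. X \<epsilon> z * G \<epsilon> \<mu> \<nu> z)"

definition cov02 :: "('n::finite \<Rightarrow> ('n pt \<Rightarrow> real) \<Rightarrow> 'n pt \<Rightarrow> real) \<Rightarrow> 'n fld3 \<Rightarrow> 'n fld2 \<Rightarrow> 'n fld3" where
  "cov02 d G X \<mu> \<nu> \<sigma> z = d \<sigma> (X \<mu> \<nu>) z
     - (\<Sum>\<epsilon>\<in>UNIV. X \<epsilon> \<nu> z * G \<epsilon> \<mu> \<sigma> z) - (\<Sum>\<epsilon>\<in>UNIV. X \<mu> \<epsilon> z * G \<epsilon> \<nu> \<sigma> z)"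

definition cov12 :: "('n::finite \<Rightarrow> ('n pt \<Rightarrow> real) \<Rightarrow> 'n pt \<Rightarrow> real) \<Rightarrow> 'n fld3 \<Rightarrow> 'n fld3 \<Rightarrow> 'n fld4" where
  "cov12 d G X \<alpha> \<mu> \<nu> \<sigma> z = d \<sigma> (X \<alpha> \<mu> \<nu>) z + (\<Sum>\<epsilon>\<in>UNIV. X \<epsilon> \<mu> \<nu> z * G \<alpha> \<epsilon> \<sigma> z)
     - (\<Sum>\<epsilon>\<in>UNIV. X \<alpha> \<epsilon> \<nu> z * G \<epsilon> \<mu> \<sigma> z) - (\<Sum>\<epsilon>\<in>UNIV. X \<alpha> \<mu> \<epsilon> z * G \<epsilon> \<nu> \<sigma> z)"

definition hcov01 :: "('n::finite) d_connection \<Rightarrow> 'n fld1 \<Rightarrow> 'n fld2" where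
  "hcov01 D = cov01 (delta (nlc D)) (hcoef D)"
definition hcov02 :: "('n::finite) d_connection \<Rightarrow> 'n fld2 \<Rightarrow> 'n fld3" where
  "hcov02 D = cov02 (delta (nlc D)) (hcoef D)"
definition hcov12 :: "('n::finite) d_connection \<Rightarrow> 'n fld3 \<Rightarrow> 'n fld4" where
  "hcov12 D = cov12 (delta (nlc D)) (hcoef D)"

definition vcov01 :: "('n::finite) d_connection \<Rightarrow> 'n fld1 \<Rightarrow> 'n fld2" where
  "vcov01 D = cov01 py (vcoef D)"
definition vcov02 :: "('n::finite) d_connection \<Rightarrow> 'n fld2 \<Rightarrow> 'n fld3" where
  "vcov02 D = cov02 py (vcoef D)"
definition vcov12 :: "('n::finite) d_connection \<Rightarrow> 'n fld3 \<Rightarrow> 'n fld4" where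
  "vcov12 D = cov12 py (vcoef D)"

definition hW_tensor :: "('n::finite) d_connection \<Rightarrow> 'n fld2 \<Rightarrow> 'n fld4" where
  "hW_tensor D L \<alpha> \<mu> \<nu> \<sigma> z =
     (THE H. \<forall>i \<mu> \<nu> \<sigma>.
        hcov02 D (hcov01 D (low L i)) \<mu> \<nu> \<sigma> z - hcov02 D (hcov01 D (low L i)) \<mu> \<sigma> \<nu> z
          = (\<Sum>\<epsilon>\<in>UNIV. low L i \<epsilon> z * H \<epsilon> \<mu> \<nu> \<sigma>)) \<alpha> \<mu> \<nu> \<sigma>"

definition vW_tensor :: "('n::finite) d_connection \<Rightarrow> 'n fld2 \<Rightarrow> 'n fld4" where
  "vW_tensor D L \<alpha> \<mu> \<nu> \<sigma> z =
     (THE V. \<forall>i \<mu> \<nu> \<sigma>.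
        vcov02 D (vcov01 D (low L i)) \<mu> \<nu> \<sigma> z - vcov02 D (vcov01 D (low L i)) \<mu> \<sigma> \<nu> z
          = (\<Sum>\<epsilon>\<in>UNIV. low L i \<epsilon> z * V \<epsilon> \<mu> \<nu> \<sigma>)) \<alpha> \<mu> \<nu> \<sigma>"

text \<open>The requirement defining a \<open>W\<close>-tensor has exactly one solution wherever the frame is
  linearly independent.\<close>

lemma W_tensor_unique:
  fixes L :: "'n::finite fld2" and K :: "'n \<Rightarrow> 'n \<Rightarrow> 'n \<Rightarrow> 'n \<Rightarrow> real"
  assumes "invertible (\<chi> j \<beta>. L j \<beta> z)"
  shows "\<exists>!H. \<forall>i \<mu> \<nu> \<sigma>. K i \<mu> \<nu> \<sigma> = (\<Sum>\<epsilon>\<in>UNIV. low L i \<epsilon> z * H \<epsilon> \<mu> \<nu> \<sigma>)"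
proof -
  let ?A = "\<chi> j \<beta>. L j \<beta> z"
  have inv: "?A ** matrix_inv ?A = mat 1" "matrix_inv ?A ** ?A = mat 1"
    using someI_ex[OF assms[unfolded invertible_def]] by (simp_all add: matrix_inv_def)
  have 1: "(\<Sum>\<epsilon>\<in>UNIV. L j \<epsilon> z * low L i \<epsilon> z) = (if i = j then 1 else 0)" for i j
    using arg_cong[OF inv(1), of "\<lambda>B. B $ j $ i"]
    by (simp add: matrix_matrix_mult_def low_def mat_def eq_commute)
  have 2: "(\<Sum>i\<in>UNIV. low L i \<beta> z * L i \<alpha> z) = (if \<alpha> = \<beta> then 1 else 0)" for \<alpha> \<beta>
    using arg_cong[OF inv(2), of "\<lambda>B. B $ \<beta> $ \<alpha>"]
    by (simp add: matrix_matrix_mult_def low_def mat_def eq_commute)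
  define H0 where "H0 \<alpha> \<mu> \<nu> \<sigma> = (\<Sum>i\<in>UNIV. L i \<alpha> z * K i \<mu> \<nu> \<sigma>)" for \<alpha> \<mu> \<nu> \<sigma>
  show ?thesis
  proof (rule ex1I[of _ H0])
    show "\<forall>i \<mu> \<nu> \<sigma>. K i \<mu> \<nu> \<sigma> = (\<Sum>\<epsilon>\<in>UNIV. low L i \<epsilon> z * H0 \<epsilon> \<mu> \<nu> \<sigma>)"
    proof (intro allI)
      fix i \<mu> \<nu> \<sigma>
      have "(\<Sum>\<epsilon>\<in>UNIV. low L i \<epsilon> z * H0 \<epsilon> \<mu> \<nu> \<sigma>)
          = (\<Sum>\<epsilon>\<in>UNIV. \<Sum>j\<in>UNIV. (L j \<epsilon> z * low L i \<epsilon> z) * K j \<mu> \<nu> \<sigma>)"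
        by (simp add: H0_def sum_distrib_left mult_ac)
      also have "\<dots> = (\<Sum>j\<in>UNIV. (\<Sum>\<epsilon>\<in>UNIV. L j \<epsilon> z * low L i \<epsilon> z) * K j \<mu> \<nu> \<sigma>)"
        by (subst sum.swap) (simp add: sum_distrib_right)
      also have "\<dots> = K i \<mu> \<nu> \<sigma>"
        by (simp add: 1 if_distrib[of "\<lambda>x. x * _"] cong: if_cong)
      finally show "K i \<mu> \<nu> \<sigma> = (\<Sum>\<epsilon>\<in>UNIV. low L i \<epsilon> z * H0 \<epsilon> \<mu> \<nu> \<sigma>)" ..
    qed
  next
    fix H assume *: "\<forall>i \<mu> \<nu> \<sigma>. K i \<mu> \<nu> \<sigma> = (\<Sum>\<epsilon>\<in>UNIV. low L i \<epsilon> z * H \<epsilon> \<mu> \<nu> \<sigma>)"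
    have "H \<alpha> \<mu> \<nu> \<sigma> = H0 \<alpha> \<mu> \<nu> \<sigma>" for \<alpha> \<mu> \<nu> \<sigma>
    proof -
      have "H0 \<alpha> \<mu> \<nu> \<sigma> = (\<Sum>i\<in>UNIV. \<Sum>\<epsilon>\<in>UNIV. (low L i \<epsilon> z * L i \<alpha> z) * H \<epsilon> \<mu> \<nu> \<sigma>)"
        by (simp add: H0_def * sum_distrib_left mult_ac)
      also have "\<dots> = (\<Sum>\<epsilon>\<in>UNIV. (\<Sum>i\<in>UNIV. low L i \<epsilon> z * L i \<alpha> z) * H \<epsilon> \<mu> \<nu> \<sigma>)"
        by (subst sum.swap) (simp add: sum_distrib_right)
      also have "\<dots> = H \<alpha> \<mu> \<nu> \<sigma>"
        by (simp add: 2 if_distrib[of "\<lambda>x. x * _"] cong: if_cong)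
      finally show ?thesis ..
    qed
    then show "H = H0" by (intro ext)
  qed
qed

definition htorsion :: "'n::finite fld2 \<Rightarrow> 'n fld2 \<Rightarrow> 'n fld3" where
  "htorsion N L \<alpha> \<mu> \<nu> z = hcoef (canonical N L) \<alpha> \<mu> \<nu> z - hcoef (canonical N L) \<alpha> \<nu> \<mu> z"

definition vtorsion :: "'n::finite fld2 \<Rightarrow> 'n fld2 \<Rightarrow> 'n fld3" where
  "vtorsion N L \<alpha> \<mu> \<nu> z = vcoef (canonical N L) \<alpha> \<mu> \<nu> z - vcoef (canonical N L) \<alpha> \<nu> \<mu> z"

definition hcontortion :: "'n::finite fld2 \<Rightarrow> 'n fld2 \<Rightarrow> 'n fld3" where
  "hcontortion N L \<alpha> \<mu> \<nu> z = hcoef (canonical N L) \<alpha> \<mu> \<nu> z - hcoef (riemannian N L) \<alpha> \<mu> \<nu> z"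

definition Lten :: "'n::finite fld2 \<Rightarrow> 'n fld2 \<Rightarrow> 'n fld4" where
  "Lten N L \<alpha> \<nu> \<mu> \<sigma> z =
     (\<Sum>\<epsilon>\<in>UNIV. vcoef (canonical N L) \<alpha> \<nu> \<epsilon> z * nl_curvature N \<epsilon> \<mu> \<sigma> z)"

definition cyclic_sum :: "('n \<Rightarrow> 'n \<Rightarrow> 'n \<Rightarrow> real) \<Rightarrow> 'n \<Rightarrow> 'n \<Rightarrow> 'n \<Rightarrow> real" where
  "cyclic_sum F \<mu> \<nu> \<sigma> = F \<mu> \<nu> \<sigma> + F \<nu> \<sigma> \<mu> + F \<sigma> \<mu> \<nu>"

end

theory Submission
  imports Defs
begin

text \<open>The canonical coefficients satisfy
  \<open>d\<^sub>\<nu> \<lambda>\<^sub>\<mu> = \<lambda>\<^sub>\<epsilon> \<Gamma>\<^sup>\<epsilon>\<^sub>\<mu>\<^sub>\<nu>\<close>, both for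
  \<open>d = \<delta>\<close> and for the vertical derivatives.  So for a connection with coefficients \<open>G\<close>
  and the difference tensor \<open>X = \<Gamma> - G\<close> the covariant derivative of the frame is
  \<open>\<lambda>\<^sub>\<epsilon> X\<^sup>\<epsilon>\<^sub>\<mu>\<^sub>\<nu>\<close>, and differentiating once more expresses the
  \<open>W\<close>-tensor through \<open>X\<close> and its canonical covariant derivative.  The tensor \<open>X\<close> is
  \<open>\<Lambda>\<close> (or \<open>T\<close>), \<open>\<Lambda>/2\<close> and \<open>\<gamma>\<close> in the dual, symmetric and Riemannian case.  In the
  dual case a first Bianchi identity is needed in addition: the commutators
  \<open>[\<delta>\<^sub>\<sigma>, \<delta>\<^sub>\<nu>]\<close> are vertical with the curvature of \<open>N\<close> as
  coefficients, which gives the cyclic sum of \<open>L\<close>, while vertical derivatives commute.\<close>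

subsection \<open>Calculus of smooth functions\<close>

text \<open>Openness of \<open>S\<close> matters: agreement on \<open>S\<close> is then agreement
  near each point, so the derivatives agree too and the induction continues with them. Formulas such
  as Cramer's rule hold only on \<open>S\<close>, so smoothness is transferred through this
  fact.\<close>

lemma Ck_on_cong:
  assumes "open S" "Ck_on k f S" "\<And>x. x \<in> S \<Longrightarrow> f x = g x"
  shows "Ck_on k g S"
  using assms(2,3)
proof (induction k arbitrary: f g)
  case 0
  then show ?case using continuous_on_cong by fastforce
next
  case (Suc k)
  have g: "(g has_derivative frechet_derivative f (at x)) (at x)" if "x \<in> S" for x
  proof -
    have "(f has_derivative frechet_derivative f (at x)) (at x)"
      using Suc.prems(1) that by (simp flip: frechet_derivative_works)
    then show ?thesis
      by (rule has_derivative_transform_within_open[OF _ assms(1) that Suc.prems(2)])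
  qed
  have "Ck_on k (\<lambda>x. frechet_derivative g (at x) v) S" for v
  proof (rule Suc.IH)
    show "Ck_on k (\<lambda>x. frechet_derivative f (at x) v) S"
      using Suc.prems(1) by simp
    show "frechet_derivative f (at x) v = frechet_derivative g (at x) v" if "x \<in> S" for x
      using frechet_derivative_at[OF g[OF that]] by (rule fun_cong)
  qed
  with g show ?case by (auto simp: differentiable_def)
qed

text \<open>Allows an explicit formula \<open>F\<close> for the derivative in place of
  \<open>frechet_derivative\<close>, which equals it on \<open>S\<close> by uniqueness of
  derivatives.\<close>

lemma Ck_on_SucI:
  assumes "open S" and F: "\<And>x. x \<in> S \<Longrightarrow> (f has_derivative F x) (at x)"
    and "\<And>v. Ck_on k (\<lambda>x. F x v) S"
  shows "Ck_on (Suc k) f S"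
proof -
  have "Ck_on k (\<lambda>x. frechet_derivative f (at x) v) S" for v
    by (rule Ck_on_cong[OF assms(1) assms(3)[of v]]) (rule fun_cong[OF frechet_derivative_at[OF F]])
  with F show ?thesis by (auto simp: differentiable_def)
qed

lemma Ck_on_Suc_has_derivative:
  "Ck_on (Suc k) f S \<Longrightarrow> x \<in> S \<Longrightarrow> (f has_derivative frechet_derivative f (at x)) (at x)"
  by (simp flip: frechet_derivative_works)

text \<open>Needed for products and reciprocals, whose derivatives again contain the
  undifferentiated functions.\<close>

lemma Ck_on_Suc_imp: "Ck_on (Suc k) f S \<Longrightarrow> Ck_on k f S"
proof (induction k arbitrary: f)
  case 0
  then show ?case
    by (auto intro!: continuous_at_imp_continuous_on differentiable_imp_continuous_within)
next
  case (Suc k)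
  then show ?case by (metis Ck_on.simps(2))
qed

lemma Ck_on_const: "open S \<Longrightarrow> Ck_on k (\<lambda>x. c) S"
proof (induction k arbitrary: c)
  case (Suc k)
  show ?case
    by (rule Ck_on_SucI[where F = "\<lambda>_ _. 0"]) (use Suc in auto)
qed simp

lemma Ck_on_add:
  assumes "open S" "Ck_on k f S" "Ck_on k g S"
  shows "Ck_on k (\<lambda>x. f x + g x) S"
  using assms(2,3)
proof (induction k arbitrary: f g)
  case (Suc k)
  have "((\<lambda>x. f x + g x) has_derivative
      (\<lambda>v. frechet_derivative f (at x) v + frechet_derivative g (at x) v)) (at x)" if "x \<in> S" for x
    using Suc.prems that by (intro has_derivative_add Ck_on_Suc_has_derivative)
  moreover have "Ck_on k (\<lambda>x. frechet_derivative f (at x) v + frechet_derivative g (at x) v) S" for v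
    using Suc by simp
  ultimately show ?case
    by (intro Ck_on_SucI[OF assms(1)])
qed (auto intro: continuous_intros)

lemma Ck_on_mult:
  fixes f g :: "'a::real_normed_vector \<Rightarrow> real"
  assumes "open S" "Ck_on k f S" "Ck_on k g S"
  shows "Ck_on k (\<lambda>x. f x * g x) S"
  using assms(2,3)
proof (induction k arbitrary: f g)
  case (Suc k)
  have "((\<lambda>x. f x * g x) has_derivative
      (\<lambda>v. f x * frechet_derivative g (at x) v + frechet_derivative f (at x) v * g x)) (at x)" if "x \<in> S" for x
    using Suc.prems that by (intro has_derivative_mult Ck_on_Suc_has_derivative)
  moreover have "Ck_on k (\<lambda>x. f x * frechet_derivative g (at x) v + frechet_derivative f (at x) v * g x) S" for v
    using Suc Ck_on_Suc_imp[OF Suc.prems(1)] Ck_on_Suc_imp[OF Suc.prems(2)]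
    by (intro Ck_on_add assms(1) Suc.IH) auto
  ultimately show ?case
    by (intro Ck_on_SucI[OF assms(1)])
qed (auto intro: continuous_intros)

text \<open>The derivative of \<open>1/f\<close> is built from \<open>1/f\<close> and the derivative
  of \<open>f\<close> by products, so the induction hypothesis for the same \<open>f\<close>
  suffices.\<close>

lemma Ck_on_inverse:
  fixes f :: "'a::real_normed_vector \<Rightarrow> real"
  assumes "open S" "Ck_on k f S" "\<And>x. x \<in> S \<Longrightarrow> f x \<noteq> 0"
  shows "Ck_on k (\<lambda>x. inverse (f x)) S"
  using assms(2)
proof (induction k)
  case (Suc k)
  let ?F = "\<lambda>x v. -1 * (inverse (f x) * frechet_derivative f (at x) v * inverse (f x))"
  have "((\<lambda>x. inverse (f x)) has_derivative ?F x) (at x)" if "x \<in> S" for x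
    using Deriv.has_derivative_inverse[OF assms(3)[OF that] Ck_on_Suc_has_derivative[OF Suc.prems that]]
    by simp
  moreover have "Ck_on k (\<lambda>x. ?F x v) S" for v
    using Suc.prems Suc.IH[OF Ck_on_Suc_imp[OF Suc.prems]]
    by (intro Ck_on_mult Ck_on_const assms(1)) auto
  ultimately show ?case
    by (intro Ck_on_SucI[OF assms(1)])
qed (auto intro!: continuous_intros assms(3))

section \<open>Closure properties of smooth functions\<close>

lemma smooth_on_cong:
  "open S \<Longrightarrow> smooth_on f S \<Longrightarrow> (\<And>x. x \<in> S \<Longrightarrow> f x = g x) \<Longrightarrow> smooth_on g S"
  unfolding smooth_on_def by (blast intro: Ck_on_cong)

lemma smooth_on_const: "open S \<Longrightarrow> smooth_on (\<lambda>x. c) S"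
  unfolding smooth_on_def by (blast intro: Ck_on_const)

lemma smooth_on_add:
  "open S \<Longrightarrow> smooth_on f S \<Longrightarrow> smooth_on g S \<Longrightarrow> smooth_on (\<lambda>x. f x + g x) S"
  unfolding smooth_on_def by (blast intro: Ck_on_add)

lemma smooth_on_mult:
  fixes f g :: "'a::real_normed_vector \<Rightarrow> real"
  shows "open S \<Longrightarrow> smooth_on f S \<Longrightarrow> smooth_on g S \<Longrightarrow> smooth_on (\<lambda>x. f x * g x) S"
  unfolding smooth_on_def by (blast intro: Ck_on_mult)

lemma smooth_on_inverse:
  fixes f :: "'a::real_normed_vector \<Rightarrow> real"
  shows "open S \<Longrightarrow> smooth_on f S \<Longrightarrow> (\<And>x. x \<in> S \<Longrightarrow> f x \<noteq> 0) \<Longrightarrow> smooth_on (\<lambda>x. inverse (f x)) S"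
  unfolding smooth_on_def by (blast intro: Ck_on_inverse)

lemma smooth_on_diff:
  fixes f g :: "'a::real_normed_vector \<Rightarrow> real"
  assumes "open S" "smooth_on f S" "smooth_on g S"
  shows "smooth_on (\<lambda>x. f x - g x) S"
  using smooth_on_add[OF assms(1,2) smooth_on_mult[OF assms(1) smooth_on_const[OF assms(1)] assms(3)], of "-1"]
  by simp

lemma smooth_on_sum:
  "open S \<Longrightarrow> (\<And>i. i \<in> I \<Longrightarrow> smooth_on (f i) S) \<Longrightarrow> smooth_on (\<lambda>x. \<Sum>i\<in>I. f i x) S"
  by (induction I rule: infinite_finite_induct) (auto intro: smooth_on_const smooth_on_add)

lemma smooth_on_prod:
  fixes f :: "'i \<Rightarrow> 'a::real_normed_vector \<Rightarrow> real"
  shows "open S \<Longrightarrow> (\<And>i. i \<in> I \<Longrightarrow> smooth_on (f i) S) \<Longrightarrow> smooth_on (\<lambda>x. \<Prod>i\<in>I. f i x) S"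
  by (induction I rule: infinite_finite_induct) (auto intro: smooth_on_const smooth_on_mult)

lemmas smooth_on_intros = smooth_on_const smooth_on_add smooth_on_diff smooth_on_mult smooth_on_sum

lemma smooth_on_imp_has_derivative:
  "smooth_on f S \<Longrightarrow> x \<in> S \<Longrightarrow> (f has_derivative frechet_derivative f (at x)) (at x)"
  unfolding smooth_on_def by (blast intro: Ck_on_Suc_has_derivative)

lemma smooth_on_directional_derivative:
  "smooth_on f S \<Longrightarrow> smooth_on (\<lambda>x. frechet_derivative f (at x) v) S"
  unfolding smooth_on_def by (metis Ck_on.simps(2))

lemma smooth_on_imp_continuous_on: "smooth_on f S \<Longrightarrow> continuous_on S f"
  unfolding smooth_on_def by (metis Ck_on.simps(1))

section \<open>Symmetry of mixed second derivatives\<close>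

lemma has_real_derivative_along_line:
  fixes f :: "'a::real_normed_vector \<Rightarrow> real"
  assumes "smooth_on f S" "a + s *\<^sub>R u \<in> S"
  shows "((\<lambda>s. f (a + s *\<^sub>R u)) has_real_derivative frechet_derivative f (at (a + s *\<^sub>R u)) u) (at s)"
proof -
  let ?D = "frechet_derivative f (at (a + s *\<^sub>R u))"
  have D: "(f has_derivative ?D) (at (a + s *\<^sub>R u))"
    by (rule smooth_on_imp_has_derivative[OF assms])
  have "((\<lambda>s. f (a + s *\<^sub>R u)) has_derivative (\<lambda>t. ?D (t *\<^sub>R u))) (at s)"
    by (rule has_derivative_compose[where g = f]) (use D in \<open>auto intro!: derivative_eq_intros\<close>)
  moreover have "(\<lambda>t. ?D (t *\<^sub>R u)) = (*) (?D u)"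
    using linear_scale[OF has_derivative_linear[OF D]] by (auto simp: mult.commute)
  ultimately show ?thesis by (simp add: has_field_derivative_def)
qed

text \<open>The second difference over the parallelogram with edges \<open>h u\<close> and
  \<open>h v\<close> is the increment over \<open>[0,h]\<close> of the function sending
  \<open>s\<close> to \<open>f (z + h v + s u) - f (z + s u)\<close>. The mean value theorem is
  applied in \<open>s\<close>, and then to the resulting increment of the
  \<open>u\<close>-derivative in direction \<open>v\<close>.\<close>

lemma second_difference_mvt:
  fixes f :: "'a::real_normed_vector \<Rightarrow> real"
  assumes f: "smooth_on f S" and h: "h > 0"
    and S: "\<And>s t. s \<in> {0..h} \<Longrightarrow> t \<in> {0..h} \<Longrightarrow> z + s *\<^sub>R u + t *\<^sub>R v \<in> S"
  shows "\<exists>s\<in>{0..h}. \<exists>t\<in>{0..h}.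
    f (z + h *\<^sub>R u + h *\<^sub>R v) - f (z + h *\<^sub>R u) - f (z + h *\<^sub>R v) + f z
      = h * h * frechet_derivative (\<lambda>x. frechet_derivative f (at x) u) (at (z + s *\<^sub>R u + t *\<^sub>R v)) v"
proof -
  let ?D = "\<lambda>x. frechet_derivative f (at x) u"
  have S0: "z + s *\<^sub>R u \<in> S" if "s \<in> {0..h}" for s
    using S[OF that, of 0] h by simp
  have Sh: "(z + h *\<^sub>R v) + s *\<^sub>R u \<in> S" if "s \<in> {0..h}" for s
    using S[OF that, of h] h by (simp add: add_ac)
  have "\<exists>s>0. s < h \<and> (f ((z + h *\<^sub>R v) + h *\<^sub>R u) - f (z + h *\<^sub>R u)) -
      (f ((z + h *\<^sub>R v) + 0 *\<^sub>R u) - f (z + 0 *\<^sub>R u))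
      = (h - 0) * (?D ((z + h *\<^sub>R v) + s *\<^sub>R u) - ?D (z + s *\<^sub>R u))"
    by (intro MVT2[OF h] DERIV_diff has_real_derivative_along_line[OF f] S0 Sh) auto
  then obtain s where s: "0 < s" "s < h" and
    1: "(f ((z + h *\<^sub>R v) + h *\<^sub>R u) - f (z + h *\<^sub>R u)) - (f (z + h *\<^sub>R v) - f z)
      = h * (?D ((z + h *\<^sub>R v) + s *\<^sub>R u) - ?D (z + s *\<^sub>R u))"
    by auto
  have "\<exists>t>0. t < h \<and> ?D ((z + s *\<^sub>R u) + h *\<^sub>R v) - ?D ((z + s *\<^sub>R u) + 0 *\<^sub>R v)
      = (h - 0) * frechet_derivative ?D (at ((z + s *\<^sub>R u) + t *\<^sub>R v)) v"
    using s by (intro MVT2[OF h] has_real_derivative_along_line[OF smooth_on_directional_derivative[OF f]] S) auto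
  then obtain t where t: "0 < t" "t < h" and
    2: "?D ((z + s *\<^sub>R u) + h *\<^sub>R v) - ?D (z + s *\<^sub>R u)
      = h * frechet_derivative ?D (at ((z + s *\<^sub>R u) + t *\<^sub>R v)) v"
    by auto
  have "f (z + h *\<^sub>R u + h *\<^sub>R v) - f (z + h *\<^sub>R u) - f (z + h *\<^sub>R v) + f z
      = h * (?D ((z + s *\<^sub>R u) + h *\<^sub>R v) - ?D (z + s *\<^sub>R u))"
    using 1 by (simp add: add_ac)
  then show ?thesis
    using 2 s t by (intro bexI[of _ s] bexI[of _ t]) auto
qed

text \<open>Schwarz's theorem. The second difference is symmetric in \<open>u\<close> and
  \<open>v\<close>, so both mixed derivatives take a common value at points of a small
  parallelogram; continuity at \<open>z\<close> brings their values at \<open>z\<close> within any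
  \<open>e\<close> of each other.\<close>

lemma second_derivative_symmetric:
  fixes f :: "'a::real_normed_vector \<Rightarrow> real"
  assumes S: "open S" and f: "smooth_on f S" and z: "z \<in> S"
  shows "frechet_derivative (\<lambda>x. frechet_derivative f (at x) u) (at z) v
       = frechet_derivative (\<lambda>x. frechet_derivative f (at x) v) (at z) u"
proof -
  let ?D = "\<lambda>u v x. frechet_derivative (\<lambda>x. frechet_derivative f (at x) u) (at x) v"
  have "\<bar>?D u v z - ?D v u z\<bar> \<le> e" if e: "e > 0" for e
  proof -
    have cont: "isCont (?D u v) z" for u v
      using smooth_on_imp_continuous_on[OF smooth_on_directional_derivative[OF smooth_on_directional_derivative[OF f]]]
        continuous_on_eq_continuous_at[OF S] z by blast
    obtain r1 where r1: "r1 > 0" "ball z r1 \<subseteq> S"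
      using S z openE by blast
    obtain r2 where r2: "r2 > 0" "\<And>x. dist x z < r2 \<Longrightarrow> dist (?D u v x) (?D u v z) < e/2"
      using cont[of u v] e unfolding continuous_at_eps_delta by (meson half_gt_zero)
    obtain r3 where r3: "r3 > 0" "\<And>x. dist x z < r3 \<Longrightarrow> dist (?D v u x) (?D v u z) < e/2"
      using cont[of v u] e unfolding continuous_at_eps_delta by (meson half_gt_zero)
    define r where "r = min r1 (min r2 r3)"
    \<comment> \<open>The summand 1 keeps \<open>q\<close> positive even for
      \<open>u = v = 0\<close>. With \<open>h = r / (2 * q)\<close> the whole parallelogram lies
      within \<open>r / 2\<close> of \<open>z\<close>.\<close>
    define q where "q = norm u + norm v + 1"
    define h where "h = r / (2 * q)"
    have r: "r > 0" using r1 r2 r3 by (simp add: r_def)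
    have q: "q > 0"
      unfolding q_def by (intro add_nonneg_pos add_nonneg_nonneg) auto
    have h: "h > 0" using r q by (simp add: h_def)
    have near: "dist (z + s *\<^sub>R u + t *\<^sub>R v) z < r" if "s \<in> {0..h}" "t \<in> {0..h}" for s t
    proof -
      have "dist (z + s *\<^sub>R u + t *\<^sub>R v) z = norm (s *\<^sub>R u + t *\<^sub>R v)"
        by (simp add: dist_norm add.assoc)
      also have "\<dots> \<le> s * norm u + t * norm v"
        using that norm_triangle_ineq[of "s *\<^sub>R u" "t *\<^sub>R v"] by simp
      also have "\<dots> \<le> h * norm u + h * norm v"
        using that by (intro add_mono mult_right_mono) auto
      also have "\<dots> \<le> h * q"
        using h by (simp add: q_def algebra_simps)
      also have "\<dots> = r / 2"
        using q by (simp add: h_def)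
      finally show ?thesis using r by simp
    qed
    have inS: "z + s *\<^sub>R u + t *\<^sub>R v \<in> S" "z + t *\<^sub>R v + s *\<^sub>R u \<in> S"
      if "s \<in> {0..h}" "t \<in> {0..h}" for s t
      using near[OF that] r1(2) by (auto simp: r_def dist_commute mem_ball subset_iff add_ac)
    obtain s t where st: "s \<in> {0..h}" "t \<in> {0..h}" and
      1: "f (z + h *\<^sub>R u + h *\<^sub>R v) - f (z + h *\<^sub>R u) - f (z + h *\<^sub>R v) + f z
        = h * h * ?D u v (z + s *\<^sub>R u + t *\<^sub>R v)"
      using second_difference_mvt[OF f h inS(1)] by blast
    obtain t' s' where st': "s' \<in> {0..h}" "t' \<in> {0..h}" and
      2: "f (z + h *\<^sub>R v + h *\<^sub>R u) - f (z + h *\<^sub>R v) - f (z + h *\<^sub>R u) + f z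
        = h * h * ?D v u (z + t' *\<^sub>R v + s' *\<^sub>R u)"
      using second_difference_mvt[OF f h inS(2)] by blast
    have swap: "z + h *\<^sub>R v + h *\<^sub>R u = z + h *\<^sub>R u + h *\<^sub>R v"
      "z + t' *\<^sub>R v + s' *\<^sub>R u = z + s' *\<^sub>R u + t' *\<^sub>R v"
      by simp_all
    \<comment> \<open>Both sides are the same second difference, computed with the two orders of the
      edges.\<close>
    have "h * h * ?D u v (z + s *\<^sub>R u + t *\<^sub>R v) = h * h * ?D v u (z + s' *\<^sub>R u + t' *\<^sub>R v)"
      using 1 2[unfolded swap] by argo
    then have "?D u v (z + s *\<^sub>R u + t *\<^sub>R v) = ?D v u (z + s' *\<^sub>R u + t' *\<^sub>R v)"
      using h by simp
    moreover have "dist (?D u v (z + s *\<^sub>R u + t *\<^sub>R v)) (?D u v z) < e/2"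
      using near[OF st] by (intro r2) (simp add: r_def)
    moreover have "dist (?D v u (z + s' *\<^sub>R u + t' *\<^sub>R v)) (?D v u z) < e/2"
      using near[OF st'] by (intro r3) (simp add: r_def)
    ultimately show ?thesis unfolding dist_real_def by linarith
  qed
  then show ?thesis
    by (metis abs_le_zero_iff eq_iff_diff_eq_0 field_le_epsilon add_0)
qed


subsection \<open>Inverse of a smooth frame\<close>

lemma
  fixes A :: "real^'n::finite^'n"
  assumes "invertible A"
  shows matrix_inv_right: "A ** matrix_inv A = mat 1"
    and matrix_inv_left: "matrix_inv A ** A = mat 1"
  using someI_ex[OF assms[unfolded invertible_def]] by (simp_all add: matrix_inv_def)

lemma matrix_inv_eqI:
  fixes A B :: "real^'n::finite^'n"
  assumes "B ** A = mat 1"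
  shows "matrix_inv A = B"
proof -
  have "A ** matrix_inv A = mat 1"
    using assms matrix_left_right_inverse by (intro matrix_inv_right) (auto simp: invertible_def)
  then have "matrix_inv A = B ** A ** matrix_inv A"
    by (simp add: assms)
  also have "\<dots> = B"
    using \<open>A ** matrix_inv A = mat 1\<close> by (simp flip: matrix_mul_assoc)
  finally show ?thesis .
qed

text \<open>Column \<open>i\<close> of the inverse solves \<open>A x = axis i 1\<close>, so Cramer's
  rule gives its entries. Smoothness of the inverse can be read off from this quotient of
  determinants.\<close>

lemma matrix_inv_cramer:
  fixes A :: "real^'n::finite^'n"
  assumes "invertible A"
  shows "matrix_inv A $ \<alpha> $ i = det (\<chi> r c. if c = \<alpha> then axis i 1 $ r else A $ r $ c) * inverse (det A)"
proof -
  have "A *v (matrix_inv A *v axis i 1) = axis i 1"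
    by (simp add: matrix_vector_mul_assoc matrix_inv_right assms)
  then have "matrix_inv A *v axis i 1
      = (\<chi> k. det (\<chi> r c. if c = k then axis i 1 $ r else A $ r $ c) / det A)"
    using cramer[of A] assms by (simp add: invertible_det_nz)
  moreover have "(matrix_inv A *v axis i 1) $ \<alpha> = matrix_inv A $ \<alpha> $ i"
    by (simp add: matrix_vector_mult_basis column_def)
  ultimately show ?thesis by (simp add: divide_inverse)
qed

lemma smooth_on_det:
  fixes A :: "'a::real_normed_vector \<Rightarrow> 'n \<Rightarrow> 'n::finite \<Rightarrow> real"
  assumes "open S" "\<And>i j. smooth_on (\<lambda>w. A w i j) S"
  shows "smooth_on (\<lambda>w. det (\<chi> i j. A w i j)) S"
  unfolding det_def by (auto intro!: assms smooth_on_intros smooth_on_prod)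

lemma smooth_on_low:
  assumes S: "open S" and L: "\<And>i \<alpha>. smooth_on (L i \<alpha>) S"
    and inv: "\<And>w. w \<in> S \<Longrightarrow> invertible (\<chi> j \<beta>. L j \<beta> w)"
  shows "smooth_on (low L i \<alpha>) S"
proof (rule smooth_on_cong[OF S])
  let ?f = "\<lambda>w. det (\<chi> r c. if c = \<alpha> then axis i 1 $ r else L r c w) * inverse (det (\<chi> j \<beta>. L j \<beta> w))"
  have "smooth_on (\<lambda>w. if c = \<alpha> then axis i 1 $ r else L r c w) S" for r c
    by (cases "c = \<alpha>") (simp_all add: L smooth_on_const[OF S])
  then show "smooth_on ?f S"
    using inv by (intro smooth_on_mult smooth_on_inverse smooth_on_det S L) (auto simp: invertible_det_nz)
  show "?f w = low L i \<alpha> w" if "w \<in> S" for w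
    unfolding low_def matrix_inv_cramer[OF inv[OF that]] by (simp cong: if_cong)
qed

text \<open>The two products of the frame matrix with its inverse, read entrywise: one contracts the
  coordinate index, the other the frame index.\<close>

lemma
  assumes "invertible (\<chi> j \<beta>. L j \<beta> w)"
  shows low_orthogonal_frame: "(\<Sum>\<epsilon>\<in>UNIV. L j \<epsilon> w * low L i \<epsilon> w) = (if i = j then 1 else 0)"
    and low_orthogonal_coord: "(\<Sum>i\<in>UNIV. low L i \<beta> w * L i \<alpha> w) = (if \<alpha> = \<beta> then 1 else 0)"
  using arg_cong[OF matrix_inv_right[OF assms], of "\<lambda>B. B $ j $ i"]
    arg_cong[OF matrix_inv_left[OF assms], of "\<lambda>B. B $ \<beta> $ \<alpha>"]
  by (auto simp: matrix_matrix_mult_def low_def mat_def)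

text \<open>If \<open>B\<close> is the inverse of the frame matrix \<open>A\<close>, the metric is
  \<open>B\<close> times its transpose, and its inverse is the transpose of \<open>A\<close> times
  \<open>A\<close>. This formula shows that the inverse metric is smooth.\<close>

lemma metric_inv_eq:
  assumes "invertible (\<chi> j \<beta>. L j \<beta> w)"
  shows "metric_inv L \<mu> \<nu> w = (\<Sum>i\<in>UNIV. L i \<mu> w * L i \<nu> w)"
proof -
  let ?A = "\<chi> j \<beta>. L j \<beta> w"
  have "transpose ?A ** ?A ** (\<chi> \<alpha> \<beta>. metric L \<alpha> \<beta> w) = mat 1"
  proof -
    have g: "(\<chi> \<alpha> \<beta>. metric L \<alpha> \<beta> w) = matrix_inv ?A ** transpose (matrix_inv ?A)"
      by (simp add: vec_eq_iff matrix_matrix_mult_def transpose_def metric_def low_def)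
    have "transpose ?A ** ?A ** (matrix_inv ?A ** transpose (matrix_inv ?A))
        = transpose ?A ** (?A ** matrix_inv ?A) ** transpose (matrix_inv ?A)"
      by (simp add: matrix_mul_assoc)
    also have "\<dots> = transpose (matrix_inv ?A ** ?A)"
      by (simp add: assms matrix_inv_right matrix_transpose_mul)
    finally show ?thesis by (simp add: g assms matrix_inv_left transpose_mat)
  qed
  then have "matrix_inv (\<chi> \<alpha> \<beta>. metric L \<alpha> \<beta> w) = transpose ?A ** ?A"
    by (rule matrix_inv_eqI)
  then show ?thesis
    by (simp add: metric_inv_def matrix_matrix_mult_def transpose_def)
qed


subsection \<open>Families of derivations\<close>

text \<open>Collects the rules shared by \<open>delta N\<close> and \<open>py\<close>, so that
  horizontal and vertical computations are carried out once. Commutation is not among them, because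
  the horizontal derivations commute only up to the curvature of \<open>N\<close>. Congruence asks
  for equality on \<open>S\<close> alone, where the fields are controlled.\<close>

locale derivations =
  fixes S :: "'n::finite pt set" and d :: "'n \<Rightarrow> ('n pt \<Rightarrow> real) \<Rightarrow> 'n pt \<Rightarrow> real"
  assumes open_S: "open S"
    and d_smooth: "smooth_on f S \<Longrightarrow> smooth_on (d \<nu> f) S"
    and d_cong: "smooth_on f S \<Longrightarrow> (\<And>w. w \<in> S \<Longrightarrow> f w = g w) \<Longrightarrow> w \<in> S \<Longrightarrow> d \<nu> f w = d \<nu> g w"
    and d_const: "w \<in> S \<Longrightarrow> d \<nu> (\<lambda>_. k) w = 0"
    and d_add: "smooth_on f S \<Longrightarrow> smooth_on g S \<Longrightarrow> w \<in> S \<Longrightarrow>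
      d \<nu> (\<lambda>w. f w + g w) w = d \<nu> f w + d \<nu> g w"
    and d_mult: "smooth_on f S \<Longrightarrow> smooth_on g S \<Longrightarrow> w \<in> S \<Longrightarrow>
      d \<nu> (\<lambda>w. f w * g w) w = f w * d \<nu> g w + d \<nu> f w * g w"
begin

lemma d_cmult: "smooth_on f S \<Longrightarrow> w \<in> S \<Longrightarrow> d \<nu> (\<lambda>w. k * f w) w = k * d \<nu> f w"
  by (simp add: d_mult d_const smooth_on_const open_S)

lemma d_diff:
  assumes "smooth_on f S" "smooth_on g S" "w \<in> S"
  shows "d \<nu> (\<lambda>w. f w - g w) w = d \<nu> f w - d \<nu> g w"
  using d_add[OF assms(1) smooth_on_mult[OF open_S smooth_on_const[OF open_S] assms(2)] assms(3), of \<nu> "-1"]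
    d_cmult[OF assms(2,3), of \<nu> "-1"]
  by simp

lemma d_sum:
  assumes "\<And>i. i \<in> I \<Longrightarrow> smooth_on (f i) S" "w \<in> S"
  shows "d \<nu> (\<lambda>w. \<Sum>i\<in>I. f i w) w = (\<Sum>i\<in>I. d \<nu> (f i) w)"
  using assms(1)
  by (induction I rule: infinite_finite_induct)
    (auto simp: d_const d_add assms(2) smooth_on_sum open_S)

lemmas smooth_intros = smooth_on_intros[OF open_S] d_smooth

end

section \<open>Coordinate derivations, adapted derivations and their commutators\<close>

lemma derivations_directional:
  fixes S :: "'n::finite pt set" and e :: "'n \<Rightarrow> 'n pt"
  assumes "open S"
  shows "derivations S (\<lambda>\<nu> f w. frechet_derivative f (at w) (e \<nu>))"
proof
  note D = smooth_on_imp_has_derivative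
  fix f g :: "'n pt \<Rightarrow> real" and \<nu> w
  show "open S" by fact
  assume f: "smooth_on f S"
  then show "smooth_on (\<lambda>w. frechet_derivative f (at w) (e \<nu>)) S"
    by (rule smooth_on_directional_derivative)
  assume w: "w \<in> S"
  { assume "\<And>w. w \<in> S \<Longrightarrow> f w = g w"
    then show "frechet_derivative f (at w) (e \<nu>) = frechet_derivative g (at w) (e \<nu>)"
      using has_derivative_transform_within_open[OF D[OF f w] assms w]
      by (metis frechet_derivative_at) }
  assume g: "smooth_on g S"
  show "frechet_derivative (\<lambda>w. f w + g w) (at w) (e \<nu>)
      = frechet_derivative f (at w) (e \<nu>) + frechet_derivative g (at w) (e \<nu>)"
    by (rule fun_cong[OF frechet_derivative_at[symmetric]]) (rule has_derivative_add[OF D[OF f w] D[OF g w]])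
  show "frechet_derivative (\<lambda>w. f w * g w) (at w) (e \<nu>)
      = f w * frechet_derivative g (at w) (e \<nu>) + frechet_derivative f (at w) (e \<nu>) * g w"
    by (rule fun_cong[OF frechet_derivative_at[symmetric]]) (rule has_derivative_mult[OF D[OF f w] D[OF g w]])
qed simp

lemma derivations_px: "open S \<Longrightarrow> derivations S px"
  and derivations_py: "open S \<Longrightarrow> derivations S py"
  using derivations_directional[of S "\<lambda>\<mu>. (axis \<mu> 1, 0)"] derivations_directional[of S "\<lambda>\<mu>. (0, axis \<mu> 1)"]
  by (simp_all add: px_def[abs_def] py_def[abs_def])

lemma
  assumes "open S" "smooth_on f S" "z \<in> S"
  shows px_px: "px \<mu> (px \<nu> f) z = px \<nu> (px \<mu> f) z"
    and py_py: "py \<mu> (py \<nu> f) z = py \<nu> (py \<mu> f) z"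
    and px_py: "px \<mu> (py \<nu> f) z = py \<nu> (px \<mu> f) z"
  unfolding px_def[abs_def] py_def[abs_def] by (rule second_derivative_symmetric[OF assms])+

context
  fixes S :: "'n::finite pt set" and N :: "'n fld2"
  assumes S: "open S" and N: "\<And>\<alpha> \<beta>. smooth_on (N \<alpha> \<beta>) S"
begin

interpretation X: derivations S px by (rule derivations_px[OF S])
interpretation Y: derivations S py by (rule derivations_py[OF S])

text \<open>A combination of derivations with function coefficients is again a derivation;
  smoothness of \<open>N\<close> makes it preserve smooth functions.\<close>

lemma derivations_delta: "derivations S (delta N)"
proof
  fix f g :: "'n pt \<Rightarrow> real" and \<nu> w
  show "open S" by (rule S)
  show "w \<in> S \<Longrightarrow> delta N \<nu> (\<lambda>_. k) w = 0" for k
    by (simp add: delta_def X.d_const Y.d_const)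
  assume f: "smooth_on f S"
  then show "smooth_on (delta N \<nu> f) S"
    unfolding delta_def[abs_def] by (intro X.smooth_intros Y.smooth_intros N)
  assume w: "w \<in> S"
  show "(\<And>w. w \<in> S \<Longrightarrow> f w = g w) \<Longrightarrow> delta N \<nu> f w = delta N \<nu> g w"
    using X.d_cong[OF f _ w] Y.d_cong[OF f _ w] by (simp add: delta_def)
  assume g: "smooth_on g S"
  show "delta N \<nu> (\<lambda>w. f w + g w) w = delta N \<nu> f w + delta N \<nu> g w"
    by (simp add: delta_def X.d_add Y.d_add f g w ring_distribs sum.distrib)
  show "delta N \<nu> (\<lambda>w. f w * g w) w = f w * delta N \<nu> g w + delta N \<nu> f w * g w"
    by (simp add: delta_def X.d_mult Y.d_mult f g w algebra_simps sum.distrib sum_distrib_left)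
qed

text \<open>The second-order terms cancel by symmetry of second derivatives. What survives comes
  from differentiating the coefficients \<open>N\<close>, hence is vertical.\<close>

lemma delta_commutator:
  assumes f: "smooth_on f S" and z: "z \<in> S"
  shows "delta N \<sigma> (delta N \<nu> f) z - delta N \<nu> (delta N \<sigma> f) z
    = - (\<Sum>\<epsilon>\<in>UNIV. nl_curvature N \<epsilon> \<nu> \<sigma> z * py \<epsilon> f z)"
proof -
  interpret D: derivations S "delta N" by (rule derivations_delta)
  have 1: "delta N \<sigma> (delta N \<nu> f) z
     = delta N \<sigma> (px \<nu> f) z - (\<Sum>\<epsilon>\<in>UNIV. N \<epsilon> \<nu> z * delta N \<sigma> (py \<epsilon> f) z)
       - (\<Sum>\<epsilon>\<in>UNIV. delta N \<sigma> (N \<epsilon> \<nu>) z * py \<epsilon> f z)" for \<sigma> \<nu>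
  proof -
    have "delta N \<nu> f = (\<lambda>w. px \<nu> f w - (\<Sum>\<epsilon>\<in>UNIV. N \<epsilon> \<nu> w * py \<epsilon> f w))"
      by (simp add: delta_def fun_eq_iff)
    then show ?thesis
      by (simp add: D.d_diff D.d_sum D.d_mult X.smooth_intros Y.smooth_intros f z N sum.distrib)
  qed
  \<comment> \<open>Exchanging \<nu> and \<sigma> fixes the first term, swaps the two single sums
    and, by \<open>3\<close>, fixes the double sum. The whole expression therefore drops out of the
    commutator.\<close>
  have 2: "delta N \<sigma> (px \<nu> f) z - (\<Sum>\<epsilon>\<in>UNIV. N \<epsilon> \<nu> z * delta N \<sigma> (py \<epsilon> f) z)
     = px \<nu> (px \<sigma> f) z - (\<Sum>\<epsilon>\<in>UNIV. N \<epsilon> \<sigma> z * px \<nu> (py \<epsilon> f) z) - (\<Sum>\<epsilon>\<in>UNIV. N \<epsilon> \<nu> z * px \<sigma> (py \<epsilon> f) z)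
       + (\<Sum>\<epsilon>\<in>UNIV. \<Sum>\<alpha>\<in>UNIV. N \<epsilon> \<nu> z * (N \<alpha> \<sigma> z * py \<alpha> (py \<epsilon> f) z))" for \<sigma> \<nu>
    by (simp add: delta_def px_px[OF S f z, of \<sigma> \<nu>] px_py[OF S f z] right_diff_distrib sum_subtractf sum_distrib_left)
  have 3: "(\<Sum>\<epsilon>\<in>UNIV. \<Sum>\<alpha>\<in>UNIV. N \<epsilon> \<nu> z * (N \<alpha> \<sigma> z * py \<alpha> (py \<epsilon> f) z))
    = (\<Sum>\<epsilon>\<in>UNIV. \<Sum>\<alpha>\<in>UNIV. N \<epsilon> \<sigma> z * (N \<alpha> \<nu> z * py \<alpha> (py \<epsilon> f) z))"
    by (subst sum.swap) (simp add: py_py[OF S f z] mult.left_commute)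
  show ?thesis
    unfolding 1 2 3 nl_curvature_def
    by (simp add: px_px[OF S f z, of \<nu> \<sigma>] left_diff_distrib sum_subtractf)
qed

end


subsection \<open>The \<open>W\<close>-tensor of a connection relative to the canonical one\<close>

text \<open>Brings a contracted expression into the form of a sum over the \<open>a \<tau>\<close>,
  so that identities can be compared coefficient by coefficient.\<close>

lemma sum_sum_mult:
  fixes a :: "'i \<Rightarrow> 'a::comm_semiring_0"
  shows "(\<Sum>\<epsilon>\<in>J. (\<Sum>\<tau>\<in>I. a \<tau> * b \<tau> \<epsilon>) * c \<epsilon>) = (\<Sum>\<tau>\<in>I. a \<tau> * (\<Sum>\<epsilon>\<in>J. b \<tau> \<epsilon> * c \<epsilon>))"
  unfolding sum_distrib_left sum_distrib_right by (subst sum.swap) (simp add: mult_ac)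

locale frame = derivations S d for S :: "'n::finite pt set" and d +
  fixes L :: "'n fld2"
  assumes frame_smooth: "smooth_on (L i \<alpha>) S"
    and frame_invertible: "w \<in> S \<Longrightarrow> invertible (\<chi> j \<beta>. L j \<beta> w)"
begin

lemma low_smooth: "smooth_on (low L i \<alpha>) S"
  by (rule smooth_on_low[OF open_S frame_smooth frame_invertible])

text \<open>This is the horizontal coefficient of the canonical connection for
  \<open>d = delta N\<close> and the vertical one for \<open>d = py\<close>.\<close>

definition coef :: "'n fld3" where
  "coef \<alpha> \<mu> \<nu> w = (\<Sum>i\<in>UNIV. L i \<alpha> w * d \<nu> (low L i \<mu>) w)"

lemma coef_smooth: "smooth_on (coef \<alpha> \<mu> \<nu>) S"
  unfolding coef_def[abs_def] by (intro smooth_intros low_smooth frame_smooth)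

text \<open>Together with \<open>frame_expansion\<close> below: passing to frame components and back
  is the identity, in either order.\<close>

lemma low_expansion:
  assumes "w \<in> S"
  shows "(\<Sum>\<epsilon>\<in>UNIV. low L i \<epsilon> w * (\<Sum>j\<in>UNIV. L j \<epsilon> w * a j)) = a i"
proof -
  have "(\<Sum>\<epsilon>\<in>UNIV. low L i \<epsilon> w * (\<Sum>j\<in>UNIV. L j \<epsilon> w * a j))
      = (\<Sum>j\<in>UNIV. (\<Sum>\<epsilon>\<in>UNIV. L j \<epsilon> w * low L i \<epsilon> w) * a j)"
    unfolding sum_distrib_left sum_distrib_right by (subst sum.swap) (simp add: mult_ac)
  also have "\<dots> = a i"
    by (simp add: low_orthogonal_frame[of L w, OF frame_invertible[OF assms]] if_distrib[of "\<lambda>x. x * _"] cong: if_cong)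
  finally show ?thesis .
qed

lemma frame_expansion:
  assumes "w \<in> S"
  shows "(\<Sum>i\<in>UNIV. L i \<alpha> w * (\<Sum>\<epsilon>\<in>UNIV. low L i \<epsilon> w * a \<epsilon>)) = a \<alpha>"
proof -
  have "(\<Sum>i\<in>UNIV. L i \<alpha> w * (\<Sum>\<epsilon>\<in>UNIV. low L i \<epsilon> w * a \<epsilon>))
      = (\<Sum>\<epsilon>\<in>UNIV. (\<Sum>i\<in>UNIV. low L i \<epsilon> w * L i \<alpha> w) * a \<epsilon>)"
    unfolding sum_distrib_left sum_distrib_right by (subst sum.swap) (simp add: mult_ac)
  also have "\<dots> = a \<alpha>"
    by (simp add: low_orthogonal_coord[of L w, OF frame_invertible[OF assms]] if_distrib[of "\<lambda>x. x * _"] cong: if_cong)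
  finally show ?thesis .
qed

lemma d_low: "w \<in> S \<Longrightarrow> d \<nu> (low L i \<mu>) w = (\<Sum>\<epsilon>\<in>UNIV. low L i \<epsilon> w * coef \<epsilon> \<mu> \<nu> w)"
  by (simp add: coef_def low_expansion)

text \<open>The product rule together with \<open>d_low\<close>: differentiating through the coframe
  acts on the coefficients \<open>X \<tau>\<close> as the canonical covariant derivative does on an
  upper index.\<close>

lemma d_low_combination:
  assumes X: "\<And>\<tau>. smooth_on (X \<tau>) S" and z: "z \<in> S"
  shows "d \<sigma> (\<lambda>w. \<Sum>\<tau>\<in>UNIV. low L i \<tau> w * X \<tau> w) z
    = (\<Sum>\<tau>\<in>UNIV. low L i \<tau> z * (d \<sigma> (X \<tau>) z + (\<Sum>\<epsilon>\<in>UNIV. coef \<tau> \<epsilon> \<sigma> z * X \<epsilon> z)))"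
  by (simp add: d_sum d_mult smooth_intros low_smooth X z d_low sum_sum_mult distrib_left sum.distrib)

text \<open>The upper index of \<open>X\<close> is already differentiated canonically by
  \<open>d_low_combination\<close>. Writing \<open>G = coef - X\<close> in the terms for the two
  lower indices makes these canonical as well and leaves the quadratic terms in
  \<open>X\<close>.\<close>

lemma cov02_cov01_low:
  assumes G: "\<And>\<alpha> \<mu> \<nu>. smooth_on (G \<alpha> \<mu> \<nu>) S"
    and X_def: "\<And>\<alpha> \<mu> \<nu> w. X \<alpha> \<mu> \<nu> w = coef \<alpha> \<mu> \<nu> w - G \<alpha> \<mu> \<nu> w"
    and z: "z \<in> S"
  shows "cov02 d G (cov01 d G (low L i)) \<mu> \<nu> \<sigma> z
    = (\<Sum>\<tau>\<in>UNIV. low L i \<tau> z * (cov12 d coef X \<tau> \<mu> \<nu> \<sigma> z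
        + (\<Sum>\<epsilon>\<in>UNIV. X \<tau> \<epsilon> \<nu> z * X \<epsilon> \<mu> \<sigma> z) + (\<Sum>\<epsilon>\<in>UNIV. X \<tau> \<mu> \<epsilon> z * X \<epsilon> \<nu> \<sigma> z)))"
proof -
  have X: "smooth_on (X \<alpha> \<mu> \<nu>) S" for \<alpha> \<mu> \<nu>
    by (rule smooth_on_cong[OF open_S, of "\<lambda>w. coef \<alpha> \<mu> \<nu> w - G \<alpha> \<mu> \<nu> w"])
      (intro smooth_intros coef_smooth G, simp add: X_def)
  have 1: "cov01 d G (low L i) \<mu> \<nu> w = (\<Sum>\<epsilon>\<in>UNIV. low L i \<epsilon> w * X \<epsilon> \<mu> \<nu> w)" if "w \<in> S" for \<mu> \<nu> w
    by (simp add: cov01_def d_low that X_def right_diff_distrib sum_subtractf)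
  \<comment> \<open>Fact \<open>1\<close> holds only on \<open>S\<close>, so the derivative is
    compared through \<open>d_cong\<close> rather than by rewriting the function.\<close>
  have 2: "d \<sigma> (cov01 d G (low L i) \<mu> \<nu>) z
      = d \<sigma> (\<lambda>w. \<Sum>\<epsilon>\<in>UNIV. low L i \<epsilon> w * X \<epsilon> \<mu> \<nu> w) z"
    by (rule d_cong[symmetric]) (use 1 z in \<open>auto intro!: smooth_intros low_smooth X\<close>)
  have G_eq: "G \<alpha> \<mu> \<nu> z = coef \<alpha> \<mu> \<nu> z - X \<alpha> \<mu> \<nu> z" for \<alpha> \<mu> \<nu>
    by (simp add: X_def)
  show ?thesis
    unfolding cov02_def 2 d_low_combination[OF X z] 1[OF z] sum_sum_mult sum_subtractf[symmetric]
      right_diff_distrib[symmetric] cov12_def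
    by (intro sum.cong refl arg_cong2[of _ _ _ _ "(*)"])
      (simp add: G_eq algebra_simps sum_subtractf)
qed

text \<open>Antisymmetrising \<open>cov02_cov01_low\<close> in \<nu> and \<sigma> exhibits the
  right-hand side as a solution of the defining requirement, and \<open>W_tensor_unique\<close>
  makes it the chosen one.\<close>

lemma W_tensor_eq:
  assumes G: "\<And>\<alpha> \<mu> \<nu>. smooth_on (G \<alpha> \<mu> \<nu>) S"
    and X_def: "\<And>\<alpha> \<mu> \<nu> w. X \<alpha> \<mu> \<nu> w = coef \<alpha> \<mu> \<nu> w - G \<alpha> \<mu> \<nu> w"
    and z: "z \<in> S"
  shows "(THE H. \<forall>i \<mu> \<nu> \<sigma>.
        cov02 d G (cov01 d G (low L i)) \<mu> \<nu> \<sigma> z - cov02 d G (cov01 d G (low L i)) \<mu> \<sigma> \<nu> z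
          = (\<Sum>\<epsilon>\<in>UNIV. low L i \<epsilon> z * H \<epsilon> \<mu> \<nu> \<sigma>)) \<alpha> \<mu> \<nu> \<sigma>
    = cov12 d coef X \<alpha> \<mu> \<nu> \<sigma> z - cov12 d coef X \<alpha> \<mu> \<sigma> \<nu> z
      + (\<Sum>\<epsilon>\<in>UNIV. X \<epsilon> \<mu> \<sigma> z * X \<alpha> \<epsilon> \<nu> z) - (\<Sum>\<epsilon>\<in>UNIV. X \<epsilon> \<mu> \<nu> z * X \<alpha> \<epsilon> \<sigma> z)
      + (\<Sum>\<epsilon>\<in>UNIV. (X \<epsilon> \<nu> \<sigma> z - X \<epsilon> \<sigma> \<nu> z) * X \<alpha> \<mu> \<epsilon> z)"
    (is "(THE H. ?P H) \<alpha> \<mu> \<nu> \<sigma> = ?H \<alpha> \<mu> \<nu> \<sigma>")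
proof -
  have "?P ?H"
    unfolding cov02_cov01_low[OF G X_def z] sum_subtractf[symmetric] right_diff_distrib[symmetric]
    by (intro allI sum.cong refl arg_cong2[of _ _ _ _ "(*)"])
      (simp add: algebra_simps sum_subtractf)
  then have "(THE H. ?P H) = ?H"
    by (rule the1_equality[OF W_tensor_unique[of L z, OF frame_invertible[OF z]]])
  then show ?thesis by simp
qed

text \<open>Applying \<open>d_low\<close> twice expresses the second derivatives of the coframe
  through \<open>coef\<close>; contraction with the frame extracts the coefficients. The right-hand
  side has the shape of a curvature, so the canonical connection fails to be flat only through the
  commutators of the \<open>d \<nu>\<close>.\<close>

lemma curvature_of_canonical:
  assumes z: "z \<in> S"
  shows "(\<Sum>i\<in>UNIV. L i \<alpha> z * (d \<sigma> (d \<nu> (low L i \<mu>)) z - d \<nu> (d \<sigma> (low L i \<mu>)) z))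
    = d \<sigma> (coef \<alpha> \<mu> \<nu>) z - d \<nu> (coef \<alpha> \<mu> \<sigma>) z
      + (\<Sum>\<epsilon>\<in>UNIV. coef \<alpha> \<epsilon> \<sigma> z * coef \<epsilon> \<mu> \<nu> z) - (\<Sum>\<epsilon>\<in>UNIV. coef \<alpha> \<epsilon> \<nu> z * coef \<epsilon> \<mu> \<sigma> z)"
proof -
  have "d \<sigma> (d \<nu> (low L i \<mu>)) z
      = (\<Sum>\<tau>\<in>UNIV. low L i \<tau> z * (d \<sigma> (coef \<tau> \<mu> \<nu>) z + (\<Sum>\<epsilon>\<in>UNIV. coef \<tau> \<epsilon> \<sigma> z * coef \<epsilon> \<mu> \<nu> z)))"
    for i \<sigma> \<nu>
    unfolding d_low_combination[OF coef_smooth z, symmetric]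
    by (rule d_cong) (use z in \<open>auto intro!: smooth_intros low_smooth simp: d_low\<close>)
  then show ?thesis
    unfolding right_diff_distrib sum_subtractf by (simp add: frame_expansion[OF z])
qed

section \<open>Torsion and the first Bianchi identity\<close>

definition torsion :: "'n fld3" where
  "torsion \<alpha> \<mu> \<nu> w = coef \<alpha> \<mu> \<nu> w - coef \<alpha> \<nu> \<mu> w"

lemma torsion_skew: "torsion \<alpha> \<nu> \<mu> z = - torsion \<alpha> \<mu> \<nu> z"
  by (simp add: torsion_def)

lemma d_torsion: "z \<in> S \<Longrightarrow> d \<sigma> (torsion \<alpha> \<mu> \<nu>) z = d \<sigma> (coef \<alpha> \<mu> \<nu>) z - d \<sigma> (coef \<alpha> \<nu> \<mu>) z"
  using d_diff[OF coef_smooth coef_smooth] by (simp add: torsion_def[abs_def])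

text \<open>After the commutators are replaced by \<open>curvature_of_canonical\<close>, both sides
  are polynomials in \<open>coef\<close> and its first derivatives, and the cyclic sums match term
  by term.\<close>

lemma bianchi:
  assumes z: "z \<in> S"
  shows "cyclic_sum (\<lambda>\<mu> \<nu> \<sigma>. cov12 d coef torsion \<alpha> \<mu> \<nu> \<sigma> z
        + (\<Sum>\<epsilon>\<in>UNIV. torsion \<epsilon> \<mu> \<nu> z * torsion \<alpha> \<sigma> \<epsilon> z)) \<mu> \<nu> \<sigma>
    = cyclic_sum (\<lambda>\<mu> \<nu> \<sigma>. \<Sum>i\<in>UNIV. L i \<alpha> z *
        (d \<sigma> (d \<nu> (low L i \<mu>)) z - d \<nu> (d \<sigma> (low L i \<mu>)) z)) \<mu> \<nu> \<sigma>"
  unfolding curvature_of_canonical[OF z] cyclic_sum_def cov12_def d_torsion[OF z] torsion_def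
  by (simp add: algebra_simps sum_subtractf sum.distrib)

text \<open>The left-hand side is that of \<open>W_tensor_eq\<close> for \<open>X = torsion\<close>.
  By skewness its two covariant derivatives are two of the three terms of the cyclic sum in
  \<open>bianchi\<close>, and its last sum is twice a product of torsions. Adding and subtracting
  the third term completes the cyclic sum and leaves the first two terms on the right.\<close>

lemma dual_W_tensor:
  assumes z: "z \<in> S"
  shows "cov12 d coef torsion \<alpha> \<mu> \<nu> \<sigma> z - cov12 d coef torsion \<alpha> \<mu> \<sigma> \<nu> z
      + (\<Sum>\<epsilon>\<in>UNIV. torsion \<epsilon> \<mu> \<sigma> z * torsion \<alpha> \<epsilon> \<nu> z) - (\<Sum>\<epsilon>\<in>UNIV. torsion \<epsilon> \<mu> \<nu> z * torsion \<alpha> \<epsilon> \<sigma> z)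
      + (\<Sum>\<epsilon>\<in>UNIV. (torsion \<epsilon> \<nu> \<sigma> z - torsion \<epsilon> \<sigma> \<nu> z) * torsion \<alpha> \<mu> \<epsilon> z)
    = cov12 d coef torsion \<alpha> \<sigma> \<nu> \<mu> z + (\<Sum>\<epsilon>\<in>UNIV. torsion \<epsilon> \<nu> \<sigma> z * torsion \<alpha> \<mu> \<epsilon> z)
      + cyclic_sum (\<lambda>\<mu> \<nu> \<sigma>. \<Sum>i\<in>UNIV. L i \<alpha> z *
        (d \<sigma> (d \<nu> (low L i \<mu>)) z - d \<nu> (d \<sigma> (low L i \<mu>)) z)) \<mu> \<nu> \<sigma>"
proof -
  have c: "cov12 d coef torsion \<alpha> \<mu> \<nu> \<sigma> z = - cov12 d coef torsion \<alpha> \<nu> \<mu> \<sigma> z" for \<mu> \<nu> \<sigma>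
    unfolding cov12_def d_torsion[OF z] by (simp add: torsion_def algebra_simps sum_subtractf)
  have t: "(\<Sum>\<epsilon>\<in>UNIV. torsion \<epsilon> a b z * torsion \<alpha> c \<epsilon> z) = - (\<Sum>\<epsilon>\<in>UNIV. torsion \<epsilon> a b z * torsion \<alpha> \<epsilon> c z)"
    "(\<Sum>\<epsilon>\<in>UNIV. torsion \<epsilon> a b z * torsion \<alpha> \<epsilon> c z) = - (\<Sum>\<epsilon>\<in>UNIV. torsion \<epsilon> b a z * torsion \<alpha> \<epsilon> c z)" for a b c
    unfolding sum_negf[symmetric] by (simp_all add: torsion_def algebra_simps)
  have "(\<Sum>\<epsilon>\<in>UNIV. (torsion \<epsilon> \<nu> \<sigma> z - torsion \<epsilon> \<sigma> \<nu> z) * torsion \<alpha> \<mu> \<epsilon> z)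
      = 2 * (\<Sum>\<epsilon>\<in>UNIV. torsion \<epsilon> \<nu> \<sigma> z * torsion \<alpha> \<mu> \<epsilon> z)"
    unfolding sum_distrib_left by (simp add: torsion_def algebra_simps)
  then show ?thesis
    using c[of \<mu> \<sigma> \<nu>] c[of \<nu> \<sigma> \<mu>] t(1)[of \<mu> \<nu> \<sigma>] t(1)[of \<nu> \<sigma> \<mu>] t(1)[of \<sigma> \<mu> \<nu>] t(2)[of \<sigma> \<mu> \<nu>]
    unfolding bianchi[OF z, symmetric] cyclic_sum_def by linarith
qed

text \<open>Terms linear in \<open>X\<close> acquire the factor 1/2 and quadratic ones 1/4; in the
  last sum skewness doubles the latter to 1/2.\<close>

lemma symmetric_W_tensor:
  assumes z: "z \<in> S"
  defines "X \<equiv> \<lambda>\<alpha> \<mu> \<nu> w. 1/2 * torsion \<alpha> \<mu> \<nu> w"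
  shows "cov12 d coef X \<alpha> \<mu> \<nu> \<sigma> z - cov12 d coef X \<alpha> \<mu> \<sigma> \<nu> z
      + (\<Sum>\<epsilon>\<in>UNIV. X \<epsilon> \<mu> \<sigma> z * X \<alpha> \<epsilon> \<nu> z) - (\<Sum>\<epsilon>\<in>UNIV. X \<epsilon> \<mu> \<nu> z * X \<alpha> \<epsilon> \<sigma> z)
      + (\<Sum>\<epsilon>\<in>UNIV. (X \<epsilon> \<nu> \<sigma> z - X \<epsilon> \<sigma> \<nu> z) * X \<alpha> \<mu> \<epsilon> z)
    = 1/2 * (cov12 d coef torsion \<alpha> \<mu> \<nu> \<sigma> z - cov12 d coef torsion \<alpha> \<mu> \<sigma> \<nu> z)
      + 1/4 * ((\<Sum>\<epsilon>\<in>UNIV. torsion \<epsilon> \<mu> \<nu> z * torsion \<alpha> \<sigma> \<epsilon> z) - (\<Sum>\<epsilon>\<in>UNIV. torsion \<epsilon> \<mu> \<sigma> z * torsion \<alpha> \<nu> \<epsilon> z))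
      + 1/2 * (\<Sum>\<epsilon>\<in>UNIV. torsion \<epsilon> \<sigma> \<nu> z * torsion \<alpha> \<epsilon> \<mu> z)"
proof -
  have T: "smooth_on (torsion \<alpha> \<mu> \<nu>) S" for \<alpha> \<mu> \<nu>
    unfolding torsion_def[abs_def] by (intro smooth_intros coef_smooth)
  have c: "cov12 d coef X \<alpha> \<mu> \<nu> \<sigma> z = 1/2 * cov12 d coef torsion \<alpha> \<mu> \<nu> \<sigma> z" for \<mu> \<nu> \<sigma>
    unfolding cov12_def X_def d_cmult[OF T z] by (simp add: algebra_simps sum_distrib_left)
  have t: "(\<Sum>\<epsilon>\<in>UNIV. X \<epsilon> a b z * X \<alpha> \<epsilon> c z) = - 1/4 * (\<Sum>\<epsilon>\<in>UNIV. torsion \<epsilon> a b z * torsion \<alpha> c \<epsilon> z)" for a b c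
    unfolding sum_distrib_left X_def by (simp add: torsion_skew[of \<alpha> c])
  have "(\<Sum>\<epsilon>\<in>UNIV. (X \<epsilon> \<nu> \<sigma> z - X \<epsilon> \<sigma> \<nu> z) * X \<alpha> \<mu> \<epsilon> z)
      = 1/2 * (\<Sum>\<epsilon>\<in>UNIV. torsion \<epsilon> \<sigma> \<nu> z * torsion \<alpha> \<epsilon> \<mu> z)"
    unfolding sum_distrib_left X_def by (simp add: torsion_skew[of _ \<nu>] torsion_skew[of \<alpha> \<mu>])
  then show ?thesis
    unfolding c t by (simp add: algebra_simps)
qed

end


subsection \<open>Frames of a GAP-space in an induced chart\<close>

context
  fixes M :: "'m topology" and A :: "('m, 'n::finite) chart set"
  assumes mfd: "smooth_manifold M A"
begin

lemma chart_openin: "c \<in> A \<Longrightarrow> openin M (fst c)"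
  and chart_open: "c \<in> A \<Longrightarrow> open (snd c ` fst c)"
  and chart_homeomorphic: "c \<in> A \<Longrightarrow> homeomorphic_map (subtopology M (fst c)) (top_of_set (snd c ` fst c)) (snd c)"
  and transition_smooth: "c \<in> A \<Longrightarrow> d \<in> A \<Longrightarrow> smooth_on (transition c d) (snd c ` (fst c \<inter> fst d))"
  using mfd by (auto simp: smooth_manifold_def split_beta)

lemma open_coord_dom: "c \<in> A \<Longrightarrow> open (coord_dom c)"
  unfolding coord_dom_def by (intro open_Times chart_open open_UNIV)

lemma chart_inj:
  assumes "c \<in> A"
  shows "inj_on (snd c) (fst c)"
  using homeomorphic_imp_injective_map[OF chart_homeomorphic[OF assms]] openin_subset[OF chart_openin[OF assms]]
  by (simp add: Int_absorb1)

lemma chart_overlap_open: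
  assumes "c \<in> A" "d \<in> A"
  shows "open (snd c ` (fst c \<inter> fst d))"
proof -
  have "openin (top_of_set (snd c ` fst c)) (snd c ` (fst c \<inter> fst d))"
    using homeomorphic_imp_open_map[OF chart_homeomorphic[OF assms(1)]] chart_openin[OF assms(2)]
    by (simp add: open_map_def openin_subtopology_Int2)
  then show ?thesis
    using openin_open_trans chart_open[OF assms(1)] by blast
qed

lemma transition_chart: "c \<in> A \<Longrightarrow> p \<in> fst c \<Longrightarrow> transition c d (snd c p) = snd d p"
  by (simp add: transition_def chart_inj)

text \<open>The Jacobian as a linear map, labelled by the point of the manifold so that composition
  over three charts takes place at a common \<open>p\<close>.\<close>

definition dtrans :: "('m, 'n) chart \<Rightarrow> ('m, 'n) chart \<Rightarrow> 'm \<Rightarrow> real^'n \<Rightarrow> real^'n" where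
  "dtrans c d p = frechet_derivative (transition c d) (at (snd c p))"

lemma transition_has_derivative:
  "c \<in> A \<Longrightarrow> d \<in> A \<Longrightarrow> p \<in> fst c \<Longrightarrow> p \<in> fst d \<Longrightarrow>
    (transition c d has_derivative dtrans c d p) (at (snd c p))"
  unfolding dtrans_def by (rule smooth_on_imp_has_derivative[OF transition_smooth]) auto

lemma dtrans_linear:
  "c \<in> A \<Longrightarrow> d \<in> A \<Longrightarrow> p \<in> fst c \<Longrightarrow> p \<in> fst d \<Longrightarrow> linear (dtrans c d p)"
  by (rule has_derivative_linear[OF transition_has_derivative])

lemma sum_jac:
  assumes "c \<in> A" "d \<in> A" "p \<in> fst c" "p \<in> fst d"
  shows "(\<Sum>\<beta>\<in>UNIV. jac c d (snd c p) \<alpha> \<beta> * y $ \<beta>) = dtrans c d p y $ \<alpha>"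
proof -
  have "((\<lambda>x. transition c d x $ \<alpha>) has_derivative (\<lambda>h. dtrans c d p h $ \<alpha>)) (at (snd c p))"
    by (rule bounded_linear.has_derivative[OF bounded_linear_vec_nth transition_has_derivative[OF assms]])
  then have "jac c d (snd c p) \<alpha> \<beta> = matrix (dtrans c d p) $ \<alpha> $ \<beta>" for \<beta>
    by (simp add: jac_def pd_def matrix_def frechet_derivative_at[symmetric])
  then show ?thesis
    using matrix_works[OF dtrans_linear[OF assms, folded linear_matrix_vector_mul_eq], of y] by (simp add: matrix_vector_mult_def vec_eq_iff)
qed

lemma dtrans_same:
  assumes "c \<in> A" "p \<in> fst c"
  shows "dtrans c c p = (\<lambda>y. y)"
proof -
  have "(transition c c has_derivative (\<lambda>y. y)) (at (snd c p))"
    using assms by (intro has_derivative_transform_within_open[OF has_derivative_ident chart_open])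
      (auto simp: transition_chart)
  then show ?thesis
    unfolding dtrans_def by (rule frechet_derivative_at[symmetric])
qed

text \<open>The chain rule; the composed transition maps agree with the direct one on the open image
  of the overlap, which determines the derivative.\<close>

lemma dtrans_cocycle:
  assumes A: "c \<in> A" "d \<in> A" "e \<in> A" and p: "p \<in> fst c" "p \<in> fst d" "p \<in> fst e"
  shows "dtrans d e p (dtrans c d p y) = dtrans c e p y"
proof -
  have "(transition d e has_derivative dtrans d e p) (at (transition c d (snd c p)))"
    using transition_has_derivative[OF A(2,3) p(2,3)] by (simp add: transition_chart A p)
  then have "(transition d e \<circ> transition c d has_derivative dtrans d e p \<circ> dtrans c d p) (at (snd c p))"
    by (rule diff_chain_at[OF transition_has_derivative[OF A(1,2) p(1,2)]])
  then have "(transition c e has_derivative dtrans d e p \<circ> dtrans c d p) (at (snd c p))"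
  proof (rule has_derivative_transform_within_open)
    show "open (snd c ` (fst c \<inter> fst d))" by (rule chart_overlap_open[OF A(1,2)])
    show "snd c p \<in> snd c ` (fst c \<inter> fst d)" using p by auto
  qed (auto simp: transition_chart A)
  then show ?thesis
    unfolding dtrans_def[of c e] by (simp add: frechet_derivative_at[symmetric])
qed

text \<open>\<open>section_comp\<close> reads a section through \<open>inv_into\<close>, which
  yields a genuine preimage only for points in the image of the induced chart.\<close>

lemma induced_chart_surj:
  assumes c: "c \<in> A" and z: "z \<in> coord_dom c"
  shows "z \<in> induced_chart c ` induced_dom M A c"
proof -
  obtain p y where p: "p \<in> fst c" and zy: "z = (snd c p, y)"
    using z by (auto simp: coord_dom_def)
  \<comment> \<open>The vector with components \<open>y\<close> in \<open>c\<close>, transported to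
    every other chart around \<open>p\<close>. The cocycle rule makes these components compatible,
    and the value 0 elsewhere is the convention of \<open>tangent_space\<close>.\<close>
  define v where "v d = (if d \<in> A \<and> p \<in> fst d then dtrans c d p y else 0)" for d
  have "v \<in> tangent_space A p"
    by (auto simp: tangent_space_def v_def sum_jac dtrans_cocycle c p)
  then have "(p, v) \<in> induced_dom M A c"
    using p openin_subset[OF chart_openin[OF c]] by (auto simp: induced_dom_def tangent_bundle_def)
  moreover have "induced_chart c (p, v) = z"
    using c p by (simp add: induced_chart_def zy v_def dtrans_same)
  ultimately show ?thesis by blast
qed

lemma tangent_vector_transform:
  assumes "v \<in> tangent_space A p" "c \<in> A" "d \<in> A" "p \<in> fst c" "p \<in> fst d"
  shows "v d = dtrans c d p (v c)"
proof -
  have "v d $ \<alpha> = (\<Sum>\<beta>\<in>UNIV. jac c d (snd c p) \<alpha> \<beta> * v c $ \<beta>)" for \<alpha>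
    using assms by (simp add: tangent_space_def)
  then show ?thesis by (simp add: vec_eq_iff sum_jac assms(2-))
qed

end

text \<open>Independence in \<open>gap_space\<close> concerns the components in all charts at once.
  A linear relation among the components in \<open>c\<close> propagates to the other charts around
  the base point by linearity of \<open>dtrans\<close>, so the rows of the component matrix are
  independent.\<close>

lemma gap_space_frame_invertible:
  assumes gap: "gap_space M A lam" and c: "c \<in> A" and z: "z \<in> coord_dom c"
  shows "invertible (\<chi> j \<beta>. section_comp M A c (lam j) \<beta> z)"
proof -
  have mfd: "smooth_manifold M A" and lam: "pullback_section M A (lam i)" for i
    using gap by (auto simp: gap_space_def)
  define u where "u = inv_into (induced_dom M A c) (induced_chart c) z"
  have "u \<in> induced_dom M A c"
    unfolding u_def by (rule inv_into_into[OF induced_chart_surj[OF mfd c z]])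
  then have u: "u \<in> tangent_bundle M A" "fst u \<in> fst c"
    by (auto simp: induced_dom_def)
  have lam_u: "lam i u \<in> tangent_space A (fst u)" for i
    using lam u by (auto simp: pullback_section_def)
  have "a i = 0" if a: "(\<Sum>i\<in>UNIV. a i *\<^sub>R lam i u c) = 0" for a :: "'b \<Rightarrow> real" and i
  proof -
    have "(\<Sum>i\<in>UNIV. a i *\<^sub>R lam i u e) = 0" for e
    proof (cases "e \<in> A \<and> fst u \<in> fst e")
      case True
      interpret D: linear "dtrans c e (fst u)"
        using True by (intro dtrans_linear[OF mfd c _ u(2)]) auto
      have "(\<Sum>i\<in>UNIV. a i *\<^sub>R lam i u e) = dtrans c e (fst u) (\<Sum>i\<in>UNIV. a i *\<^sub>R lam i u c)"
        using True by (simp add: D.sum D.scale tangent_vector_transform[OF mfd lam_u c _ u(2)])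
      then show ?thesis by (simp add: a D.zero)
    next
      case False
      then have "lam i u e = 0" for i
        using lam_u[of i] unfolding tangent_space_def by blast
      then show ?thesis by simp
    qed
    then show ?thesis using gap u by (auto simp: gap_space_def)
  qed
  then show ?thesis
    unfolding invertible_right_inverse matrix_right_invertible_independent_rows
    by (simp add: row_def section_comp_def u_def scalar_mult_eq_scaleR)
qed


subsection \<open>The four \<open>W\<close>-tensors\<close>

context
  fixes N L :: "'n::finite fld2" and S :: "'n pt set"
  assumes S: "open S" and N: "\<And>\<alpha> \<beta>. smooth_on (N \<alpha> \<beta>) S"
    and L: "\<And>i \<alpha>. smooth_on (L i \<alpha>) S"
    and inv: "\<And>w. w \<in> S \<Longrightarrow> invertible (\<chi> j \<beta>. L j \<beta> w)"
begin

interpretation H: frame S "delta N" L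
  by (intro frame.intro frame_axioms.intro derivations_delta S N L inv)

interpretation V: frame S py L
  by (intro frame.intro frame_axioms.intro derivations_py S L inv)

text \<open>The interpretations \<open>H\<close> and \<open>V\<close> equip the same frame with
  horizontal and vertical derivations; from here on the concrete tensors are identified with the
  abstract ones.\<close>

lemma hcoef_canonical: "hcoef (canonical N L) = H.coef"
  by (simp add: canonical_def H.coef_def[abs_def])

lemma vcoef_canonical: "vcoef (canonical N L) = V.coef"
  by (simp add: canonical_def V.coef_def[abs_def])

lemma htorsion_eq: "htorsion N L = H.torsion"
  by (simp add: htorsion_def[abs_def] H.torsion_def[abs_def] hcoef_canonical)

lemma vtorsion_eq: "vtorsion N L = V.torsion"
  by (simp add: vtorsion_def[abs_def] V.torsion_def[abs_def] vcoef_canonical)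

lemma hcov12_canonical: "hcov12 (canonical N L) = cov12 (delta N) H.coef"
  by (simp add: hcov12_def hcoef_canonical) (simp add: canonical_def)

lemma vcov12_canonical: "vcov12 (canonical N L) = cov12 py V.coef"
  by (simp add: vcov12_def vcoef_canonical)

section \<open>Symmetry and smoothness of the Riemannian coefficients\<close>

lemma metric_sym: "metric L \<mu> \<nu> = metric L \<nu> \<mu>"
  by (simp add: metric_def[abs_def] mult.commute)

lemma riemannian_sym: "hcoef (riemannian N L) \<alpha> \<mu> \<nu> z = hcoef (riemannian N L) \<alpha> \<nu> \<mu> z"
  by (simp add: riemannian_def metric_sym[of \<mu> \<nu>] add.commute)

lemma riemannian_smooth: "smooth_on (hcoef (riemannian N L) \<alpha> \<mu> \<nu>) S"
proof -
  have g_inv: "smooth_on (metric_inv L \<alpha> \<beta>) S" for \<alpha> \<beta>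
    by (rule smooth_on_cong[OF S, of "\<lambda>w. \<Sum>i\<in>UNIV. L i \<alpha> w * L i \<beta> w"])
      (auto intro!: smooth_on_intros S L simp: metric_inv_eq inv)
  have g: "smooth_on (metric L \<alpha> \<beta>) S" for \<alpha> \<beta>
    unfolding metric_def[abs_def] by (intro smooth_on_intros S H.low_smooth)
  show ?thesis
    unfolding riemannian_def d_connection.select_convs by (intro H.smooth_intros g_inv g)
qed

section \<open>The W-tensors at a point of the chart\<close>

context
  fixes z assumes z: "z \<in> S"
begin

text \<open>The minus sign of \<open>delta_commutator\<close> is absorbed by skewness of the
  curvature, hence the order \<sigma> \<nu> in \<open>Lten\<close>.\<close>

lemma delta_commutator_low:
  "(\<Sum>i\<in>UNIV. L i \<alpha> z * (delta N \<sigma> (delta N \<nu> (low L i \<mu>)) z - delta N \<nu> (delta N \<sigma> (low L i \<mu>)) z))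
    = Lten N L \<alpha> \<mu> \<sigma> \<nu> z"
proof -
  have "(\<Sum>i\<in>UNIV. L i \<alpha> z * (delta N \<sigma> (delta N \<nu> (low L i \<mu>)) z - delta N \<nu> (delta N \<sigma> (low L i \<mu>)) z))
    = (\<Sum>i\<in>UNIV. \<Sum>\<epsilon>\<in>UNIV. L i \<alpha> z * py \<epsilon> (low L i \<mu>) z * nl_curvature N \<epsilon> \<sigma> \<nu> z)"
    unfolding delta_commutator[OF S N H.low_smooth z] sum_negf[symmetric] sum_distrib_left
    by (intro sum.cong refl) (simp add: nl_curvature_def algebra_simps)
  also have "\<dots> = Lten N L \<alpha> \<mu> \<sigma> \<nu> z"
    unfolding Lten_def vcoef_canonical V.coef_def sum_distrib_right by (rule sum.swap)
  finally show ?thesis .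
qed

lemma hW_dual:
  "hW_tensor (dual N L) L \<alpha> \<mu> \<nu> \<sigma> z
    = hcov12 (canonical N L) (htorsion N L) \<alpha> \<sigma> \<nu> \<mu> z
      + (\<Sum>\<epsilon>\<in>UNIV. htorsion N L \<epsilon> \<nu> \<sigma> z * htorsion N L \<alpha> \<mu> \<epsilon> z)
      + cyclic_sum (\<lambda>\<mu> \<nu> \<sigma>. Lten N L \<alpha> \<mu> \<sigma> \<nu> z) \<mu> \<nu> \<sigma>"
proof -
  have D: "nlc (dual N L) = N" "hcoef (dual N L) = (\<lambda>\<alpha> \<mu> \<nu>. H.coef \<alpha> \<nu> \<mu>)"
    by (simp_all add: dual_def hcoef_canonical)
  show ?thesis
    unfolding hW_tensor_def hcov01_def hcov02_def D hcov12_canonical htorsion_eq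
      H.W_tensor_eq[OF H.coef_smooth H.torsion_def z] H.dual_W_tensor[OF z] delta_commutator_low ..
qed

lemma vW_dual:
  "vW_tensor (dual N L) L \<alpha> \<mu> \<nu> \<sigma> z
    = vcov12 (canonical N L) (vtorsion N L) \<alpha> \<sigma> \<nu> \<mu> z
      + (\<Sum>\<epsilon>\<in>UNIV. vtorsion N L \<epsilon> \<nu> \<sigma> z * vtorsion N L \<alpha> \<mu> \<epsilon> z)"
proof -
  have D: "vcoef (dual N L) = (\<lambda>\<alpha> \<mu> \<nu>. V.coef \<alpha> \<nu> \<mu>)"
    by (simp add: dual_def vcoef_canonical)
  \<comment> \<open>Vertical derivatives commute, so the cyclic sum in
    \<open>V.dual_W_tensor\<close> vanishes.\<close>
  have "py \<sigma> (py \<nu> (low L i \<mu>)) z - py \<nu> (py \<sigma> (low L i \<mu>)) z = 0" for i \<mu> \<nu> \<sigma>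
    using py_py[OF S V.low_smooth z] by simp
  then show ?thesis
    unfolding vW_tensor_def vcov01_def vcov02_def D vcov12_canonical vtorsion_eq
      V.W_tensor_eq[OF V.coef_smooth V.torsion_def z] V.dual_W_tensor[OF z]
    by (simp add: cyclic_sum_def)
qed

lemma hW_symmetric:
  "hW_tensor (symmetric N L) L \<alpha> \<mu> \<nu> \<sigma> z
    = 1/2 * (hcov12 (canonical N L) (htorsion N L) \<alpha> \<mu> \<nu> \<sigma> z - hcov12 (canonical N L) (htorsion N L) \<alpha> \<mu> \<sigma> \<nu> z)
      + 1/4 * ((\<Sum>\<epsilon>\<in>UNIV. htorsion N L \<epsilon> \<mu> \<nu> z * htorsion N L \<alpha> \<sigma> \<epsilon> z)
        - (\<Sum>\<epsilon>\<in>UNIV. htorsion N L \<epsilon> \<mu> \<sigma> z * htorsion N L \<alpha> \<nu> \<epsilon> z))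
      + 1/2 * (\<Sum>\<epsilon>\<in>UNIV. htorsion N L \<epsilon> \<sigma> \<nu> z * htorsion N L \<alpha> \<epsilon> \<mu> z)"
proof -
  have D: "nlc (symmetric N L) = N"
    "hcoef (symmetric N L) = (\<lambda>\<alpha> \<mu> \<nu> w. 1/2 * (H.coef \<alpha> \<mu> \<nu> w + H.coef \<alpha> \<nu> \<mu> w))"
    by (simp_all add: symmetric_def hcoef_canonical)
  have smooth: "smooth_on (\<lambda>w. 1/2 * (H.coef \<alpha> \<mu> \<nu> w + H.coef \<alpha> \<nu> \<mu> w)) S" for \<alpha> \<mu> \<nu>
    by (intro H.smooth_intros H.coef_smooth)
  have X: "1/2 * H.torsion \<alpha> \<mu> \<nu> w = H.coef \<alpha> \<mu> \<nu> w - 1/2 * (H.coef \<alpha> \<mu> \<nu> w + H.coef \<alpha> \<nu> \<mu> w)"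
    for \<alpha> \<mu> \<nu> w
    by (simp add: H.torsion_def field_simps)
  show ?thesis
    unfolding hW_tensor_def hcov01_def hcov02_def D hcov12_canonical htorsion_eq
      H.W_tensor_eq[where X = "\<lambda>\<alpha> \<mu> \<nu> w. 1/2 * H.torsion \<alpha> \<mu> \<nu> w", OF smooth X z]
    by (rule H.symmetric_W_tensor[OF z])
qed

lemma hW_riemannian:
  "hW_tensor (riemannian N L) L \<alpha> \<mu> \<nu> \<sigma> z
    = hcov12 (canonical N L) (hcontortion N L) \<alpha> \<mu> \<nu> \<sigma> z - hcov12 (canonical N L) (hcontortion N L) \<alpha> \<mu> \<sigma> \<nu> z
      + (\<Sum>\<epsilon>\<in>UNIV. hcontortion N L \<epsilon> \<mu> \<sigma> z * hcontortion N L \<alpha> \<epsilon> \<nu> z)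
      - (\<Sum>\<epsilon>\<in>UNIV. hcontortion N L \<epsilon> \<mu> \<nu> z * hcontortion N L \<alpha> \<epsilon> \<sigma> z)
      + (\<Sum>\<epsilon>\<in>UNIV. htorsion N L \<epsilon> \<nu> \<sigma> z * hcontortion N L \<alpha> \<mu> \<epsilon> z)"
proof -
  have X: "hcontortion N L \<alpha> \<mu> \<nu> w = H.coef \<alpha> \<mu> \<nu> w - hcoef (riemannian N L) \<alpha> \<mu> \<nu> w" for \<alpha> \<mu> \<nu> w
    by (simp add: hcontortion_def hcoef_canonical)
  have N_eq: "nlc (riemannian N L) = N"
    by (simp add: riemannian_def)
  \<comment> \<open>The Riemannian coefficients are symmetric, so the skew part of the contortion is
    the full torsion; this produces the mixed term in the formula.\<close>
  have "hcontortion N L \<epsilon> \<nu> \<sigma> z - hcontortion N L \<epsilon> \<sigma> \<nu> z = htorsion N L \<epsilon> \<nu> \<sigma> z" for \<epsilon>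
    unfolding hcontortion_def htorsion_def using riemannian_sym[of \<epsilon> \<nu> \<sigma>] by simp
  then show ?thesis
    unfolding hW_tensor_def hcov01_def hcov02_def N_eq hcov12_canonical
      H.W_tensor_eq[OF riemannian_smooth X z] by simp
qed

end

end

theorem theorem7p2:
  fixes M :: "'m topology"
    and A :: "('m, 'n::finite) chart set"
    and lam :: "'n \<Rightarrow> 'm \<times> ('m, 'n) tvec \<Rightarrow> ('m, 'n) tvec"
    and NN :: "('m, 'n) chart \<Rightarrow> 'n \<Rightarrow> 'n \<Rightarrow> 'n pt \<Rightarrow> real"
    and c :: "('m, 'n) chart" and z :: "'n pt" and \<alpha> \<mu> \<nu> \<sigma> :: 'n
  assumes "gap_space M A lam"
    and "nonlinear_connection M A NN"
    and "c \<in> A" and "z \<in> coord_dom c"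
  shows "let L = (\<lambda>i. section_comp M A c (lam i)); N = NN c; D = canonical N L;
             \<Lambda> = htorsion N L; T = vtorsion N L; \<gamma> = hcontortion N L
         in
      hW_tensor (dual N L) L \<alpha> \<mu> \<nu> \<sigma> z
        = hcov12 D \<Lambda> \<alpha> \<sigma> \<nu> \<mu> z + (\<Sum>\<epsilon>\<in>UNIV. \<Lambda> \<epsilon> \<nu> \<sigma> z * \<Lambda> \<alpha> \<mu> \<epsilon> z)
          + cyclic_sum (\<lambda>\<mu> \<nu> \<sigma>. Lten N L \<alpha> \<mu> \<sigma> \<nu> z) \<mu> \<nu> \<sigma>
    \<and> vW_tensor (dual N L) L \<alpha> \<mu> \<nu> \<sigma> z
        = vcov12 D T \<alpha> \<sigma> \<nu> \<mu> z + (\<Sum>\<epsilon>\<in>UNIV. T \<epsilon> \<nu> \<sigma> z * T \<alpha> \<mu> \<epsilon> z)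
    \<and> hW_tensor (symmetric N L) L \<alpha> \<mu> \<nu> \<sigma> z
        = 1/2 * (hcov12 D \<Lambda> \<alpha> \<mu> \<nu> \<sigma> z - hcov12 D \<Lambda> \<alpha> \<mu> \<sigma> \<nu> z)
          + 1/4 * ((\<Sum>\<epsilon>\<in>UNIV. \<Lambda> \<epsilon> \<mu> \<nu> z * \<Lambda> \<alpha> \<sigma> \<epsilon> z) - (\<Sum>\<epsilon>\<in>UNIV. \<Lambda> \<epsilon> \<mu> \<sigma> z * \<Lambda> \<alpha> \<nu> \<epsilon> z))
          + 1/2 * (\<Sum>\<epsilon>\<in>UNIV. \<Lambda> \<epsilon> \<sigma> \<nu> z * \<Lambda> \<alpha> \<epsilon> \<mu> z)
    \<and> hW_tensor (riemannian N L) L \<alpha> \<mu> \<nu> \<sigma> z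
        = hcov12 D \<gamma> \<alpha> \<mu> \<nu> \<sigma> z - hcov12 D \<gamma> \<alpha> \<mu> \<sigma> \<nu> z
          + (\<Sum>\<epsilon>\<in>UNIV. \<gamma> \<epsilon> \<mu> \<sigma> z * \<gamma> \<alpha> \<epsilon> \<nu> z) - (\<Sum>\<epsilon>\<in>UNIV. \<gamma> \<epsilon> \<mu> \<nu> z * \<gamma> \<alpha> \<epsilon> \<sigma> z)
          + (\<Sum>\<epsilon>\<in>UNIV. \<Lambda> \<epsilon> \<nu> \<sigma> z * \<gamma> \<alpha> \<mu> \<epsilon> z)"
proof -
  define L where "L = (\<lambda>i. section_comp M A c (lam i))"
  have S: "open (coord_dom c)"
    using assms(1,3) by (intro open_coord_dom) (auto simp: gap_space_def)
  have N: "smooth_on (NN c \<alpha> \<beta>) (coord_dom c)" for \<alpha> \<beta>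
    using assms(2,3) by (simp add: nonlinear_connection_def)
  have L: "smooth_on (L i \<alpha>) (coord_dom c)" for i \<alpha>
    using assms(1,3) by (simp add: L_def gap_space_def pullback_section_def)
  have inv: "invertible (\<chi> j \<beta>. L j \<beta> w)" if "w \<in> coord_dom c" for w
    unfolding L_def by (rule gap_space_frame_invertible[OF assms(1,3) that])
  note hyps = S N L inv assms(4)
  show ?thesis
    unfolding Let_def L_def[symmetric]
    by (intro conjI hW_dual[OF hyps] vW_dual[OF hyps] hW_symmetric[OF hyps] hW_riemannian[OF hyps])
qed

end
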